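(* Let $\Theta=(V,E)$ be a finite directed graph which is either a finite tree directed toward a root or a finite directed cycle. Then $\mathrm{encost}_{r,\epsilon}(\Theta)=1$ for every $r\in\mathbb{N}$ and every $\epsilon>0$.
   Context: $\mathbb{F}$ is the free group of rank two with fixed free generators $a,b$, identity $e$, word length $|\cdot|$, and $\mathbb{B}_r=\{g\in\mathbb{F}:|g|\le r\}$. For $d\in\mathbb{N}$ and finite $F\subseteq\mathbb{F}$, a function $\mathsf{C}:F\to\mathrm{Mat}_{d\times d}(\mathbb{C})$ is positive definite if $\sum_{g,h\in S}\alpha(h)^\ast\mathsf{C}(h^{-1}g)\alpha(g)\ge 0$ for every $S\subseteq\mathbb{F}$ with $S^{-1}S\subseteq F$ and every $\alpha:S\to\mathbb{C}^d$; it is strictly positive definite if moreover equality holds only for $\alpha\equiv 0$; it is normalized if $\mathsf{C}(e)=\mathbf{I}_d$. A function on all of $\mathbb{F}$ is (strictly) positive definite if all its restrictions to finite sets are. $\mathrm{NSPD}(r,d)$ denotes the set of normalized strictly positive definite functions $\mathbb{B}_r\to\mathrm{Mat}_{d\times d}(\mathbb{C})$. Realizations: for $\mathsf{C}\in\mathrm{NSPD}(2s,d)$ (note $\mathbb{B}_s^{-1}\mathbb{B}_s=\mathbb{B}_{2s}$) there is a Hilbert space $\mathscr{X}(\mathsf{C})$ and $\Phi_\mathsf{C}:\mathbb{B}_s\to\mathscr{X}(\mathsf{C})^d$ with $\langle\Phi_\mathsf{C}(g)_j,\Phi_\mathsf{C}(h)_k\rangle=\mathsf{C}(h^{-1}g)_{j,k}$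 for all $g,h\in\mathbb{B}_s$, $j,k\in[d]$, whose coordinates span (and are linearly independent in) $\mathscr{X}(\mathsf{C})$. For $\mathsf{C},\mathsf{D}\in\mathrm{NSPD}(2s,d)$ the transport operator $t[\mathsf{C},\mathsf{D}]:\mathscr{X}(\mathsf{C})\to\mathscr{X}(\mathsf{D})$ is the linear map sending $\sum_{g\in\mathbb{B}_s}\sum_j\alpha(g)_j\Phi_\mathsf{C}(g)_j$ to $\sum_{g\in\mathbb{B}_s}\sum_j\alpha(g)_j\Phi_\mathsf{D}(g)_j$, and the relative energy $\mathfrak{e}(\mathsf{C},\mathsf{D})$ is the square of its operator norm (relative energies of normalized strictly positive definite functions on a ball $\mathbb{B}_r$ are understood via this definition, with realizations indexed by the ball $\mathbb{B}_s$ satisfying $\mathbb{B}_s^{-1}\mathbb{B}_s\subseteq\mathbb{B}_r$ as in the paper). For strictly positive definite $\mathsf{C},\mathsf{D}:\mathbb{F}\to\mathrm{Mat}_{d\times d}(\mathbb{C})$, $\mathfrak{e}(\mathsf{C},\mathsf{D})=\sup_r\mathfrak{e}(\mathsf{C}\upharpoonright\mathbb{B}_r,\mathsf{D}\upharpoonright\mathbb{B}_r)$ (possibly $\infty$). A $d$-dimensional radius-$r$ configuration over a finite directed graph $\Theta=(V,E)$ is a family $\mathbf{C}=(\mathsf{C}_v)_{v\in V}$ of elements of $\mathrm{NSPD}(r,d)$. For $\epsilon>0$, $\mathrm{encost}_\epsilon(\mathbf{C})$ is the infimum of all $M\in[1,\infty)$ such that there exist positive definite $\hat{\mathsf{C}}_v:\mathbb{F}\to\mathrm{Mat}_{d\times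 d}(\mathbb{C})$ ($v\in V$) with $\max(\mathfrak{e}(\mathsf{C}_v,\hat{\mathsf{C}}_v\upharpoonright\mathbb{B}_r),\mathfrak{e}(\hat{\mathsf{C}}_v\upharpoonright\mathbb{B}_r,\mathsf{C}_v))\le 1+\epsilon$ for all $v$ and $\mathfrak{e}(\hat{\mathsf{C}}_v,\hat{\mathsf{C}}_w)-1\le M(\mathfrak{e}(\mathsf{C}_v,\mathsf{C}_w)-1)$ for all $(v,w)\in E$ (with $\inf\emptyset=\infty$). Then $\mathrm{encost}_{r,\epsilon}(\Theta)=\sup_{\mathbf{C}}\mathrm{encost}_\epsilon(\mathbf{C})$, the supremum over all $d\in\mathbb{N}$ and all $d$-dimensional radius-$r$ configurations over $\Theta$. *)

theory Defs
  imports Complex_Main "HOL-Library.Extended_Real"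
begin

section \<open>The free group of rank two on generators a, b\<close>

datatype gen = Ga | Gb

(* a letter is a generator together with a flag: True = inverse of the generator *)
type_synonym letter = "gen \<times> bool"
type_synonym word = "letter list"

definition letter_inv :: "letter \<Rightarrow> letter" where
  "letter_inv x = (fst x, \<not> snd x)"

fun reduced :: "word \<Rightarrow> bool" where
  "reduced (x # y # ys) = (y \<noteq> letter_inv x \<and> reduced (y # ys))"
| "reduced _ = True"

(* elements of the free group F = reduced words *)
definition FG :: "word set" where
  "FG = {w. reduced w}"

fun cancel_cons :: "letter \<Rightarrow> word \<Rightarrow> word" where
  "cancel_cons x [] = [x]"
| "cancel_cons x (y # ys) = (if y = letter_inv x then ys else x # y # ys)"

(* group multiplication (on reduced words) *)
definition fg_mult :: "word \<Rightarrow> word \<Rightarrow> word" where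
  "fg_mult u v = foldr cancel_cons u v"

definition fg_inv :: "word \<Rightarrow> word" where
  "fg_inv w = rev (map letter_inv w)"

(* identity e is the empty word [];  word length |g| is length g *)
definition ball :: "nat \<Rightarrow> word set" where
  "ball r = {w \<in> FG. length w \<le> r}"

section \<open>Matrix valued positive definite functions\<close>

(* d x d complex matrices are represented as nat \<Rightarrow> nat \<Rightarrow> complex, indices < d *)
type_synonym cmat = "nat \<Rightarrow> nat \<Rightarrow> complex"

(* sum_{g,h in S} alpha(h)^* C(h^{-1} g) alpha(g) *)
definition qf :: "nat \<Rightarrow> (word \<Rightarrow> cmat) \<Rightarrow> word set \<Rightarrow> (word \<Rightarrow> nat \<Rightarrow> complex) \<Rightarrow> complex" where
  "qf d C S \<alpha> = (\<Sum>g\<in>S. \<Sum>h\<in>S. \<Sum>j<d. \<Sum>k<d.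
       cnj (\<alpha> h j) * C (fg_mult (fg_inv h) g) j k * \<alpha> g k)"

definition admissible :: "word set \<Rightarrow> word set \<Rightarrow> bool" where
  "admissible F S \<longleftrightarrow> S \<subseteq> FG \<and> finite S \<and> (\<forall>g\<in>S. \<forall>h\<in>S. fg_mult (fg_inv h) g \<in> F)"

definition pos_def_on :: "nat \<Rightarrow> word set \<Rightarrow> (word \<Rightarrow> cmat) \<Rightarrow> bool" where
  "pos_def_on d F C \<longleftrightarrow> (\<forall>S \<alpha>. admissible F S \<longrightarrow>
      Im (qf d C S \<alpha>) = 0 \<and> 0 \<le> Re (qf d C S \<alpha>))"

definition strict_pos_def_on :: "nat \<Rightarrow> word set \<Rightarrow> (word \<Rightarrow> cmat) \<Rightarrow> bool" where
  "strict_pos_def_on d F C \<longleftrightarrow> pos_def_on d F C \<and>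
     (\<forall>S \<alpha>. admissible F S \<and> qf d C S \<alpha> = 0 \<longrightarrow> (\<forall>g\<in>S. \<forall>j<d. \<alpha> g j = 0))"

(* positive definite on all of F: all restrictions to finite subsets are *)
definition pos_def :: "nat \<Rightarrow> (word \<Rightarrow> cmat) \<Rightarrow> bool" where
  "pos_def d C \<longleftrightarrow> (\<forall>F. finite F \<and> F \<subseteq> FG \<longrightarrow> pos_def_on d F C)"

definition normalized :: "nat \<Rightarrow> (word \<Rightarrow> cmat) \<Rightarrow> bool" where
  "normalized d C \<longleftrightarrow> (\<forall>j<d. \<forall>k<d. C [] j k = (if j = k then 1 else 0))"

definition NSPD :: "nat \<Rightarrow> nat \<Rightarrow> (word \<Rightarrow> cmat) set" where
  "NSPD r d = {C. strict_pos_def_on d (ball r) C \<and> normalized d C}"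

section \<open>Relative energy\<close>

(* ||t x||^2 / ||x||^2 for x = sum alpha Phi_C, t x = sum alpha Phi_D;
   x = 0 with t x \<noteq> 0 (transport not well defined) gives \<infinity> *)
definition en_ratio :: "real \<Rightarrow> real \<Rightarrow> ereal" where
  "en_ratio num den = (if den = 0 then (if num = 0 then 0 else \<infinity>) else ereal (num / den))"

(* squared operator norm of the transport operator t[C,D], realizations indexed by B_s, s = r div 2 *)
definition energy_ball :: "nat \<Rightarrow> nat \<Rightarrow> (word \<Rightarrow> cmat) \<Rightarrow> (word \<Rightarrow> cmat) \<Rightarrow> ereal" where
  "energy_ball d r C D = Sup {en_ratio (Re (qf d D (ball (r div 2)) \<alpha>)) (Re (qf d C (ball (r div 2)) \<alpha>)) |
      \<alpha>. \<exists>g\<in>ball (r div 2). \<exists>j<d. \<alpha> g j \<noteq> 0}"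

definition energy :: "nat \<Rightarrow> (word \<Rightarrow> cmat) \<Rightarrow> (word \<Rightarrow> cmat) \<Rightarrow> ereal" where
  "energy d C D = (SUP r. energy_ball d r C D)"

section \<open>Energy cost\<close>

definition encost_cfg :: "nat \<Rightarrow> nat \<Rightarrow> real \<Rightarrow> 'v set \<Rightarrow> ('v \<times> 'v) set \<Rightarrow> ('v \<Rightarrow> word \<Rightarrow> cmat) \<Rightarrow> ereal" where
  "encost_cfg d r \<epsilon> V E C = Inf (ereal ` {M. 1 \<le> M \<and>
     (\<exists>Ch :: 'v \<Rightarrow> word \<Rightarrow> cmat.
        (\<forall>v\<in>V. pos_def d (Ch v) \<and>
            max (energy_ball d r (C v) (Ch v)) (energy_ball d r (Ch v) (C v)) \<le> ereal (1 + \<epsilon>)) \<and>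
        (\<forall>(v, w)\<in>E. energy d (Ch v) (Ch w) - 1 \<le> ereal M * (energy_ball d r (C v) (C w) - 1)))})"

definition encost :: "nat \<Rightarrow> real \<Rightarrow> 'v set \<Rightarrow> ('v \<times> 'v) set \<Rightarrow> ereal" where
  "encost r \<epsilon> V E = (SUP d\<in>{1..}. SUP C\<in>{C. \<forall>v\<in>V. C v \<in> NSPD r d}. encost_cfg d r \<epsilon> V E C)"

section \<open>Graphs\<close>

(* finite tree with all edges directed toward a root \<rho> *)
definition tree_toward_root :: "'v set \<Rightarrow> ('v \<times> 'v) set \<Rightarrow> bool" where
  "tree_toward_root V E \<longleftrightarrow> (\<exists>\<rho>\<in>V.
      (\<forall>(v, w)\<in>E. v \<noteq> \<rho>) \<and>
      (\<forall>v\<in>V - {\<rho>}. \<exists>!w. (v, w) \<in> E) \<and>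
      (\<forall>v\<in>V. (v, \<rho>) \<in> E\<^sup>*))"

definition directed_cycle :: "'v set \<Rightarrow> ('v \<times> 'v) set \<Rightarrow> bool" where
  "directed_cycle V E \<longleftrightarrow> (\<exists>(n::nat) (f::nat \<Rightarrow> 'v). 1 \<le> n \<and> bij_betw f {..<n} V \<and>
      E = {(f i, f ((i + 1) mod n)) | i. i < n})"

end

theory Submission
  imports Defs "HOL-Library.Function_Algebras"
begin

text \<open>Every positive semidefinite form on \<open>B\<^sub>s\<close> that depends only on \<open>h\<^sup>-\<^sup>1g\<close> extends to a positive
  definite function on the free group: each generator acts as a partial isometry on the span of the
  realization of the ball, this partial isometry (extended by zero) is a contraction, and the products of
  these contractions along reduced words form a positive definite function because the Cayley graph is a
  tree.

  In both kinds of graph every vertex \<open>v\<close> has at most one outgoing edge \<open>(v, w)\<close>. The definition of the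
  relative energy \<open>e\<close> says that \<open>C\<^sub>v - C\<^sub>w / e\<close> is positive semidefinite on the ball. Solving for the
  \<open>C\<^sub>v\<close> in terms of these residuals and replacing every residual by an extension to the free group gives
  exact extensions of the \<open>C\<^sub>v\<close> with no larger energies, so \<open>M = 1\<close> is attained.\<close>

section \<open>Reduced words\<close>

lemma letter_inv_letter_inv [simp]: "letter_inv (letter_inv x) = x"
  by (simp add: letter_inv_def)

lemma letter_inv_eq_iff: "letter_inv x = y \<longleftrightarrow> x = letter_inv y"
  by auto

lemma reduced_Cons:
  "reduced (x # w) \<longleftrightarrow> reduced w \<and> (w = [] \<or> hd w \<noteq> letter_inv x)"
  by (cases w) auto

lemma reduced_append:
  "reduced (u @ w) \<longleftrightarrow>
     reduced u \<and> reduced w \<and> (u = [] \<or> w = [] \<or> hd w \<noteq> letter_inv (last u))"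
  by (induction u) (auto simp: reduced_Cons hd_append)

lemma fg_inv_Nil [simp]: "fg_inv [] = []"
  by (simp add: fg_inv_def)

lemma fg_inv_Cons: "fg_inv (x # w) = fg_inv w @ [letter_inv x]"
  by (simp add: fg_inv_def)

lemma length_fg_inv [simp]: "length (fg_inv w) = length w"
  by (simp add: fg_inv_def)

lemma fg_inv_fg_inv [simp]: "fg_inv (fg_inv w) = w"
  by (simp add: fg_inv_def rev_map comp_def)

lemma fg_inv_eq_Nil_iff [simp]: "fg_inv w = [] \<longleftrightarrow> w = []"
  by (simp add: fg_inv_def)

lemma last_fg_inv: "w \<noteq> [] \<Longrightarrow> last (fg_inv w) = letter_inv (hd w)"
  by (simp add: fg_inv_def last_rev hd_map)

lemma reduced_fg_inv: "reduced w \<Longrightarrow> reduced (fg_inv w)"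
  by (induction w) (auto simp: fg_inv_Cons reduced_append reduced_Cons last_fg_inv letter_inv_eq_iff)

lemma fg_mult_Nil [simp]: "fg_mult [] w = w"
  by (simp add: fg_mult_def)

lemma fg_mult_Cons: "fg_mult (x # u) w = cancel_cons x (fg_mult u w)"
  by (simp add: fg_mult_def)

lemma fg_mult_snoc: "fg_mult (u @ [x]) w = fg_mult u (cancel_cons x w)"
  by (simp add: fg_mult_def)

lemma cancel_cons_reduced: "reduced (x # w) \<Longrightarrow> cancel_cons x w = x # w"
  by (cases w) auto

lemma reduced_cancel_cons: "reduced w \<Longrightarrow> reduced (cancel_cons x w)"
  by (cases w) (auto simp: reduced_Cons)

lemma cancel_cons_inverse: "reduced w \<Longrightarrow> cancel_cons (letter_inv x) (cancel_cons x w) = w"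
  by (cases w) (auto simp: reduced_Cons intro!: cancel_cons_reduced)

lemma length_cancel_cons: "length (cancel_cons x w) \<le> Suc (length w)"
  by (cases w) auto

lemma reduced_fg_mult: "reduced w \<Longrightarrow> reduced (fg_mult u w)"
  by (induction u) (auto simp: fg_mult_Cons reduced_cancel_cons)

lemma length_fg_mult: "length (fg_mult u w) \<le> length u + length w"
proof (induction u)
  case (Cons x u)
  then show ?case
    using length_cancel_cons[of x "fg_mult u w"] by (simp add: fg_mult_Cons)
qed simp

lemma fg_mult_eq_append: "reduced (u @ w) \<Longrightarrow> fg_mult u w = u @ w"
proof (induction u)
  case (Cons x u)
  then show ?case by (simp add: fg_mult_Cons reduced_Cons cancel_cons_reduced)
qed simp

section \<open>Words of the form h^{-1} g: common prefixes and left translation\<close>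

lemma fg_mult_inv_Cons_Cons:
  "fg_mult (fg_inv (x # h)) (x # g) = fg_mult (fg_inv h) g"
  by (simp add: fg_inv_Cons fg_mult_snoc)

lemma fg_mult_inv_eq_append:
  assumes "reduced g" "reduced h" "g = [] \<or> h = [] \<or> hd g \<noteq> hd h"
  shows "fg_mult (fg_inv h) g = fg_inv h @ g"
  using assms
  by (intro fg_mult_eq_append) (auto simp: reduced_append reduced_fg_inv last_fg_inv)

text \<open>The letter \<open>x\<close> and its inverse meet in the middle of the product and
  cancel. This invariance makes left translation by a letter a symmetry of
  \<open>qf_kernel C\<close> in \<open>extension_from_ball\<close>.\<close>

lemma fg_mult_inv_cancel_cons:
  assumes "reduced g"
  shows "fg_mult (fg_inv (cancel_cons x h)) (cancel_cons x g) = fg_mult (fg_inv h) g"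
proof (cases "h \<noteq> [] \<and> hd h = letter_inv x")
  case True
  then obtain h' where "h = letter_inv x # h'" by (cases h) auto
  then show ?thesis by (simp add: fg_inv_Cons fg_mult_snoc)
next
  case False
  then have "cancel_cons x h = x # h" by (cases h) auto
  then show ?thesis using assms by (simp add: fg_inv_Cons fg_mult_snoc cancel_cons_inverse)
qed

text \<open>Stripping the common prefix leaves a concatenation, which is empty only if both
  remainders are. It shows that the form of the delta function in \<open>NSPD_nonempty\<close> is
  diagonal.\<close>

lemma fg_mult_inv_eq_Nil_iff:
  "reduced g \<Longrightarrow> reduced h \<Longrightarrow> fg_mult (fg_inv h) g = [] \<longleftrightarrow> g = h"
proof (induction g arbitrary: h)
  case Nil
  then show ?case by (auto simp: fg_mult_inv_eq_append)
next
  case (Cons x g)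
  show ?case
  proof (cases "h \<noteq> [] \<and> hd h = x")
    case True
    then obtain h' where "h = x # h'" by (cases h) auto
    then show ?thesis using Cons by (auto simp: fg_mult_inv_Cons_Cons reduced_Cons)
  next
    case False
    then show ?thesis using Cons.prems by (subst fg_mult_inv_eq_append) auto
  qed
qed

lemma ball_iff: "w \<in> ball r \<longleftrightarrow> reduced w \<and> length w \<le> r"
  by (simp add: ball_def FG_def)

lemma Nil_in_ball [simp]: "[] \<in> ball r"
  by (simp add: ball_iff)

lemma ball_subset_FG: "ball r \<subseteq> FG"
  by (auto simp: ball_def)

instance gen :: finite
proof
  have "(UNIV :: gen set) = {Ga, Gb}" using gen.exhaust by auto
  then show "finite (UNIV :: gen set)" by (metis finite.emptyI finite.insertI)
qed

lemma finite_words_le: "finite {w :: 'a::finite list. length w \<le> n}"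
  using finite_lists_length_le[OF finite_UNIV, of n] by simp

lemma finite_ball [simp]: "finite (ball r)"
  by (rule finite_subset[OF _ finite_words_le[of r]]) (auto simp: ball_def)

lemma fg_mult_inv_in_ball:
  "g \<in> ball s \<Longrightarrow> h \<in> ball s \<Longrightarrow> fg_mult (fg_inv h) g \<in> ball (2 * s)"
  using length_fg_mult[of "fg_inv h" g] by (auto simp: ball_iff reduced_fg_mult)

section \<open>Positive semidefinite kernels\<close>

text \<open>A semi-inner product on coefficient functions, conjugate-linear in the second argument.
  Vectors of the realization are handled through their coefficients, without a quotient by null
  vectors.\<close>

definition gram :: "'i set \<Rightarrow> ('i \<Rightarrow> 'i \<Rightarrow> complex) \<Rightarrow> ('i \<Rightarrow> complex) \<Rightarrow> ('i \<Rightarrow> complex) \<Rightarrow> complex"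
  where "gram I G u v = (\<Sum>i\<in>I. \<Sum>j\<in>I. u i * G i j * cnj (v j))"

definition unit_vec :: "'i \<Rightarrow> 'i \<Rightarrow> complex"
  where "unit_vec i = (\<lambda>j. if j = i then 1 else 0)"

definition supported :: "'i set \<Rightarrow> ('i \<Rightarrow> complex) set"
  where "supported L = {u. \<forall>i. i \<notin> L \<longrightarrow> u i = 0}"

locale psd_kernel =
  fixes I :: "'i set" and G :: "'i \<Rightarrow> 'i \<Rightarrow> complex"
  assumes finite_I: "finite I"
    and Im_gram_self: "Im (gram I G u u) = 0"
    and Re_gram_self: "0 \<le> Re (gram I G u u)"
begin

abbreviation B where "B \<equiv> gram I G"

lemma B_add_left: "B (u + v) w = B u w + B v w"
  by (simp add: gram_def algebra_simps sum.distrib)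

lemma B_diff_left: "B (u - v) w = B u w - B v w"
  by (simp add: gram_def algebra_simps sum_subtractf)

lemma B_zero_left: "B 0 w = 0"
  by (simp add: gram_def)

lemma B_scale_left: "B (\<lambda>i. c * u i) w = c * B u w"
  by (simp add: gram_def sum_distrib_left mult.assoc)

lemma B_add_right: "B w (u + v) = B w u + B w v"
  by (simp add: gram_def algebra_simps sum.distrib)

lemma B_scale_right: "B w (\<lambda>i. c * u i) = cnj c * B w u"
  by (simp add: gram_def sum_distrib_left mult_ac)

text \<open>Polarization: realness of the form at u + v relates the imaginary parts, realness at u +
  iv the real parts.\<close>

lemma B_hermitian: "B v u = cnj (B u v)"
proof -
  have 1: "Im (B u v + B v u) = 0"
    using Im_gram_self[of "u + v"] Im_gram_self[of u] Im_gram_self[of v]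
    by (simp add: B_add_left B_add_right)
  let ?w = "\<lambda>i. \<i> * v i"
  have 2: "Im (B u ?w + B ?w u) = 0"
    using Im_gram_self[of "u + ?w"] Im_gram_self[of u] Im_gram_self[of ?w]
    by (simp add: B_add_left B_add_right)
  from 1 2 show ?thesis
    by (simp add: B_scale_left B_scale_right complex_eq_iff)
qed

lemma B_diff_right: "B w (u - v) = B w u - B w v"
  by (simp add: B_hermitian[of w] B_diff_left)

lemma B_sum_left: "B (\<Sum>a\<in>A. f a) w = (\<Sum>a\<in>A. B (f a) w)"
  by (induction A rule: infinite_finite_induct)
     (simp_all only: sum.infinite sum.empty sum.insert B_zero_left B_add_left not_False_eq_True)

lemma B_sum_right: "B w (\<Sum>a\<in>A. f a) = (\<Sum>a\<in>A. B w (f a))"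
  by (simp add: B_hermitian[of w] B_sum_left)

lemma B_sum_sum: "B (\<Sum>a\<in>A. f a) (\<Sum>b\<in>A'. g b) = (\<Sum>a\<in>A. \<Sum>b\<in>A'. B (f a) (g b))"
  by (subst B_sum_left) (simp only: B_sum_right)

lemma B_expand_left: "B u w = (\<Sum>i\<in>I. u i * B (unit_vec i) w)"
proof -
  have "B (unit_vec i) w = (\<Sum>j\<in>I. G i j * cnj (w j))" if "i \<in> I" for i
  proof -
    have "B (unit_vec i) w = (\<Sum>i'\<in>I. if i' = i then \<Sum>j\<in>I. G i j * cnj (w j) else 0)"
      unfolding gram_def unit_vec_def by (intro sum.cong) auto
    then show ?thesis using that finite_I by simp
  qed
  then show ?thesis by (simp add: gram_def sum_distrib_left mult.assoc)
qed

lemma B_unit_vec: "i \<in> I \<Longrightarrow> j \<in> I \<Longrightarrow> B (unit_vec i) (unit_vec j) = G i j"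
proof -
  assume ij: "i \<in> I" "j \<in> I"
  have "B (unit_vec i) (unit_vec j) =
      (\<Sum>i'\<in>I. if i' = i then (\<Sum>j'\<in>I. if j' = j then G i j else 0) else 0)"
    unfolding gram_def unit_vec_def by (auto intro!: sum.cong)
  then show ?thesis using ij finite_I by simp
qed

text \<open>A null vector lies in the radical: otherwise, moving u far enough along a multiple of m
  would make the form negative.\<close>

lemma B_null:
  assumes "B m m = 0"
  shows "B u m = 0"
proof (rule ccontr)
  assume "B u m \<noteq> 0"
  \<comment> \<open>\<open>t\<close> is chosen so that the form at u + c m takes exactly the value
    -1.\<close>
  define t where "t = - (Re (B u u) + 1) / (2 * (cmod (B u m))\<^sup>2)"
  define c where "c = of_real t * B u m"
  have mu: "B m u = cnj (B u m)" by (rule B_hermitian)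
  have "B (u + (\<lambda>i. c * m i)) (u + (\<lambda>i. c * m i)) = B u u + cnj c * B u m + c * B m u"
    using assms by (simp add: B_add_left B_add_right B_scale_left B_scale_right)
  also have "\<dots> = B u u + of_real (2 * t * (cmod (B u m))\<^sup>2)"
    using complex_norm_square[of "B u m"] by (simp add: c_def mu mult_ac)
  finally have "Re (B (u + (\<lambda>i. c * m i)) (u + (\<lambda>i. c * m i))) =
      Re (B u u) + 2 * t * (cmod (B u m))\<^sup>2"
    by (simp only: plus_complex.sel Re_complex_of_real)
  moreover have "2 * t * (cmod (B u m))\<^sup>2 = - (Re (B u u) + 1)"
    using \<open>B u m \<noteq> 0\<close> by (simp add: t_def)
  ultimately have "Re (B (u + (\<lambda>i. c * m i)) (u + (\<lambda>i. c * m i))) = - 1" by simp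
  then show False using Re_gram_self[of "u + (\<lambda>i. c * m i)"] by simp
qed

text \<open>Gram-Schmidt, adding one index at a time; the form may be degenerate, so the projection
  is unique only up to null vectors.\<close>

lemma projection_exists:
  "finite L \<Longrightarrow> \<exists>p\<in>supported L. \<forall>w\<in>supported L. B (v - p) w = 0"
proof (induction L arbitrary: v rule: finite_induct)
  case empty
  have "supported {} = {0 :: 'i \<Rightarrow> complex}" by (auto simp: supported_def)
  then show ?case by (simp add: gram_def)
next
  case (insert m L)
  obtain p where p: "p \<in> supported L" "\<And>w. w \<in> supported L \<Longrightarrow> B (v - p) w = 0"
    using insert.IH[of v] by blast
  obtain n where n: "n \<in> supported L" "\<And>w. w \<in> supported L \<Longrightarrow> B (unit_vec m - n) w = 0"
    using insert.IH[of "unit_vec m"] by blast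
  define m' where "m' = unit_vec m - n"
  \<comment> \<open>If \<open>m'\<close> is null, division by zero gives \<open>c = 0\<close>;
    orthogonality to \<open>m'\<close> then comes from \<open>B_null\<close>.\<close>
  define c where "c = B (v - p) m' / B m' m'"
  define q where "q = p + (\<lambda>i. c * m' i)"
  have q: "q \<in> supported (insert m L)"
    using p(1) n(1) by (auto simp: q_def m'_def supported_def unit_vec_def)
  have res: "B (v - q) w = B (v - p) w - c * B m' w" for w
    by (simp add: q_def B_diff_left B_add_left B_scale_left)
  have L: "B (v - q) w = 0" if "w \<in> supported L" for w
    using that p(2) n(2) by (simp add: res m'_def)
  have m': "B (v - q) m' = 0"
    using B_null[of m' "v - p"] by (cases "B m' m' = 0") (auto simp: res c_def)
  have "B (v - q) w = 0" if w: "w \<in> supported (insert m L)" for w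
  proof -
    \<comment> \<open>As \<open>n\<close> vanishes at \<open>m\<close>, the coefficient of
      \<open>m'\<close> at \<open>m\<close> is 1, so the subtraction removes the coordinate of
      \<open>w\<close> at \<open>m\<close>.\<close>
    have "w - (\<lambda>i. w m * m' i) \<in> supported L"
      using w n(1) \<open>m \<notin> L\<close> by (auto simp: supported_def m'_def unit_vec_def)
    then have "B (v - q) (w - (\<lambda>i. w m * m' i)) = 0" by (rule L)
    then show ?thesis by (simp add: B_diff_right B_scale_right m')
  qed
  with q show ?case by blast
qed

text \<open>Among the possible projections, the unit vectors of \<open>L\<close> are made to project
  to themselves literally, not just modulo null vectors. This later gives
  \<open>T x (unit_vec i) = unit_vec (\<sigma> x i)\<close> as an equation of functions.\<close>

lemma projection_vectors_exist:
  assumes "finite L"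
  obtains p where "\<And>i. p i \<in> supported L"
    and "\<And>i. i \<in> L \<Longrightarrow> p i = unit_vec i"
    and "\<And>i w. w \<in> supported L \<Longrightarrow> B (unit_vec i) w = B (p i) w"
proof -
  have "\<exists>q. q \<in> supported L \<and> (i \<in> L \<longrightarrow> q = unit_vec i) \<and>
      (\<forall>w\<in>supported L. B (unit_vec i) w = B q w)" for i
  proof (cases "i \<in> L")
    case True
    then have "unit_vec i \<in> supported L" by (auto simp: supported_def unit_vec_def)
    then show ?thesis by blast
  next
    case False
    then show ?thesis
      using projection_exists[OF assms, of "unit_vec i"]
      by (metis B_diff_left eq_iff_diff_eq_0)
  qed
  then have "\<exists>p. \<forall>i. p i \<in> supported L \<and> (i \<in> L \<longrightarrow> p i = unit_vec i) \<and>
      (\<forall>w\<in>supported L. B (unit_vec i) w = B (p i) w)"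
    by (intro choice allI)
  then show ?thesis using that by blast
qed

text \<open>Projections chosen separately for each vector need not depend linearly on it. Choosing
  them on unit vectors only and extending linearly repairs this.\<close>

lemma linear_projection_exists:
  assumes "finite L"
  obtains P where "\<And>u. P u \<in> supported L"
    and "\<And>i. i \<in> L \<Longrightarrow> i \<in> I \<Longrightarrow> P (unit_vec i) = unit_vec i"
    and "\<And>u v. P (u + v) = P u + P v"
    and "\<And>c u. P (\<lambda>i. c * u i) = (\<lambda>i. c * P u i)"
    and "\<And>u w. w \<in> supported L \<Longrightarrow> B u w = B (P u) w"
proof -
  obtain p where p: "\<And>i. p i \<in> supported L" "\<And>i. i \<in> L \<Longrightarrow> p i = unit_vec i"
    "\<And>i w. w \<in> supported L \<Longrightarrow> B (unit_vec i) w = B (p i) w"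
    using projection_vectors_exist[OF assms] by blast
  define P where "P u = (\<lambda>j. \<Sum>i\<in>I. u i * p i j)" for u
  have sum_fun: "P u = (\<Sum>i\<in>I. (\<lambda>j. u i * p i j))" for u
  proof -
    have "(\<Sum>i\<in>A. (\<lambda>j. u i * p i j)) j = (\<Sum>i\<in>A. u i * p i j)" for A j
      by (induction A rule: infinite_finite_induct) auto
    then show ?thesis unfolding P_def by (intro ext) simp
  qed
  show thesis
  proof (rule that[of P])
    show "P u \<in> supported L" for u using p(1) by (auto simp: P_def supported_def)
    show "P (unit_vec i) = unit_vec i" if "i \<in> L" "i \<in> I" for i
    proof
      fix j
      have "P (unit_vec i) j = (\<Sum>i'\<in>I. if i' = i then p i j else 0)"
        unfolding P_def by (intro sum.cong) (auto simp: unit_vec_def)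
      then show "P (unit_vec i) j = unit_vec i j" using that p(2) finite_I by simp
    qed
    show "P (u + v) = P u + P v" for u v
      by (rule ext) (simp add: P_def algebra_simps sum.distrib)
    show "P (\<lambda>i. c * u i) = (\<lambda>i. c * P u i)" for c u
      by (simp add: P_def sum_distrib_left mult.assoc)
    show "B u w = B (P u) w" if "w \<in> supported L" for u w
    proof -
      have "B u w = (\<Sum>i\<in>I. u i * B (p i) w)"
        by (subst B_expand_left) (simp add: p(3)[OF that])
      then show ?thesis unfolding sum_fun by (simp only: B_sum_left B_scale_left)
    qed
  qed
qed

text \<open>\<open>T x\<close> is the partial isometry induced by \<open>\<sigma> x\<close>, preceded by the projection onto the span of its
  domain.\<close>

lemma partial_symmetries_act:
  fixes \<sigma> :: "'x \<Rightarrow> 'i \<Rightarrow> 'i" and L :: "'x \<Rightarrow> 'i set" and inverse :: "'x \<Rightarrow> 'x"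
  assumes L: "\<And>x. L x \<subseteq> I"
    and inv: "\<And>x. inverse (inverse x) = x"
    and \<sigma>: "\<And>x i. i \<in> L x \<Longrightarrow> \<sigma> x i \<in> L (inverse x)"
    and \<sigma>_inv: "\<And>x i. i \<in> L x \<Longrightarrow> \<sigma> (inverse x) (\<sigma> x i) = i"
    and G: "\<And>x i j. i \<in> L x \<Longrightarrow> j \<in> L x \<Longrightarrow> G (\<sigma> x i) (\<sigma> x j) = G i j"
  obtains T where "\<And>x u v. T x (u + v) = T x u + T x v"
    and "\<And>x c u. T x (\<lambda>i. c * u i) = (\<lambda>i. c * T x u i)"
    and "\<And>x u v. B (T x u) v = B u (T (inverse x) v)"
    and "\<And>x u. Re (B (T x u) (T x u)) \<le> Re (B u u)"
    and "\<And>x i. i \<in> L x \<Longrightarrow> T x (unit_vec i) = unit_vec (\<sigma> x i)"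
proof -
  have fin: "finite (L x)" for x using L finite_I finite_subset by blast
  have "\<exists>P. \<forall>x. (\<forall>u. P x u \<in> supported (L x)) \<and> (\<forall>i\<in>L x. P x (unit_vec i) = unit_vec i) \<and>
      (\<forall>u v. P x (u + v) = P x u + P x v) \<and> (\<forall>c u. P x (\<lambda>i. c * u i) = (\<lambda>i. c * P x u i)) \<and>
      (\<forall>u. \<forall>w\<in>supported (L x). B u w = B (P x u) w)"
    by (rule choice, rule allI, rule linear_projection_exists[OF fin]) (use L in blast)
  then obtain P where P: "\<And>x u. P x u \<in> supported (L x)"
      "\<And>x i. i \<in> L x \<Longrightarrow> P x (unit_vec i) = unit_vec i"
      "\<And>x u v. P x (u + v) = P x u + P x v"
      "\<And>x c u. P x (\<lambda>i. c * u i) = (\<lambda>i. c * P x u i)"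
      "\<And>x u w. w \<in> supported (L x) \<Longrightarrow> B u w = B (P x u) w"
    by blast
  \<comment> \<open>\<open>U x\<close> pushes coefficients forward along the partial bijection
    \<open>\<sigma> x\<close>, written as a pullback along its inverse and extended by zero.\<close>
  define U where "U x u = (\<lambda>i. if i \<in> L (inverse x) then u (\<sigma> (inverse x) i) else 0)"
    for x and u :: "'i \<Rightarrow> complex"
  have bij: "bij_betw (\<sigma> x) (L x) (L (inverse x))" for x
    using \<sigma>[of _ x] \<sigma>_inv[of _ x] \<sigma>[of _ "inverse x"] \<sigma>_inv[of _ "inverse x"]
    by (intro bij_betw_byWitness[where f' = "\<sigma> (inverse x)"]) (auto simp: inv)
  have U_supp: "U x u \<in> supported (L (inverse x))" for x u
    by (simp add: U_def supported_def)
  have U_\<sigma>: "U x u (\<sigma> x i) = u i" if "i \<in> L x" for x u i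
    using that \<sigma> \<sigma>_inv by (simp add: U_def)
  have B_supp: "B u v = (\<Sum>i\<in>L x. \<Sum>j\<in>L x. u i * G i j * cnj (v j))"
    if "u \<in> supported (L x)" "v \<in> supported (L x)" for x u v
  proof -
    have "B u v = (\<Sum>i\<in>L x. \<Sum>j\<in>I. u i * G i j * cnj (v j))"
      unfolding gram_def using that(1) L finite_I
      by (intro sum.mono_neutral_right) (auto simp: supported_def)
    also have "\<dots> = (\<Sum>i\<in>L x. \<Sum>j\<in>L x. u i * G i j * cnj (v j))"
      using that(2) L finite_I
      by (intro sum.cong sum.mono_neutral_right) (auto simp: supported_def)
    finally show ?thesis .
  qed
  have U_iso: "B (U x u) (U x v) = B u v"
    if "u \<in> supported (L x)" "v \<in> supported (L x)" for x u v
  proof -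
    have "B (U x u) (U x v) =
      (\<Sum>i\<in>L (inverse x). \<Sum>j\<in>L (inverse x). U x u i * G i j * cnj (U x v j))"
      by (intro B_supp U_supp)
    also have "\<dots> = (\<Sum>i\<in>L x. \<Sum>j\<in>L x. U x u (\<sigma> x i) * G (\<sigma> x i) (\<sigma> x j) * cnj (U x v (\<sigma> x j)))"
      by (simp add: sum.reindex_bij_betw[OF bij, symmetric])
    also have "\<dots> = B u v"
      using that by (simp add: B_supp U_\<sigma> G)
    finally show ?thesis .
  qed
  have U_inv: "U x (U (inverse x) u) = u" if "u \<in> supported (L (inverse x))" for x u
  proof
    fix i
    show "U x (U (inverse x) u) i = u i"
      using that \<sigma>[of i "inverse x"] \<sigma>_inv[of i "inverse x"]
      by (auto simp: U_def inv supported_def)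
  qed
  define T where "T x u = U x (P x u)" for x u
  show thesis
  proof (rule that[of T])
    show "T x (u + v) = T x u + T x v" for x u v
      by (rule ext) (simp add: T_def U_def P(3))
    show "T x (\<lambda>i. c * u i) = (\<lambda>i. c * T x u i)" for x c u
      by (rule ext) (simp add: T_def U_def P(4))
    show "B (T x u) v = B u (T (inverse x) v)" for x u v
    proof -
      have "B (T x u) v = cnj (B v (T x u))" by (rule B_hermitian)
      also have "\<dots> = cnj (B (P (inverse x) v) (T x u))"
        using P(5)[of "T x u" "inverse x" v] U_supp by (simp add: T_def)
      also have "\<dots> = B (T x u) (P (inverse x) v)" by (rule B_hermitian[symmetric])
      also have "\<dots> = B (U x (P x u)) (U x (T (inverse x) v))"
        by (simp add: T_def U_inv P(1))
      also have "\<dots> = B (P x u) (T (inverse x) v)"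
        using U_supp[of "inverse x"] by (intro U_iso P(1)) (simp add: T_def inv)
      also have "\<dots> = B u (T (inverse x) v)"
        using P(5)[of "T (inverse x) v" x u] U_supp[of "inverse x"] by (simp add: T_def inv)
      finally show ?thesis .
    qed
    show "Re (B (T x u) (T x u)) \<le> Re (B u u)" for x u
    proof -
      have 1: "B u (P x u) = B (P x u) (P x u)" by (rule P(5)[OF P(1)])
      have 2: "B (P x u) u = B (P x u) (P x u)"
        using B_hermitian[of "P x u" u] B_hermitian[of "P x u" "P x u"] 1 by simp
      \<comment> \<open>Pythagoras for the projection; \<open>U x\<close> then preserves the
        form.\<close>
      have "B (u - P x u) (u - P x u) = B u u - B (P x u) (P x u)"
        using 1 2 by (simp add: B_diff_left B_diff_right)
      then have "Re (B (P x u) (P x u)) \<le> Re (B u u)"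
        using Re_gram_self[of "u - P x u"] by simp
      then show ?thesis by (simp add: T_def U_iso P(1))
    qed
    show "T x (unit_vec i) = unit_vec (\<sigma> x i)" if "i \<in> L x" for x i
    proof
      fix j
      show "T x (unit_vec i) j = unit_vec (\<sigma> x i) j"
        using that \<sigma>[of i x] \<sigma>_inv[of i x] \<sigma>_inv[of j "inverse x"]
        unfolding T_def P(2)[OF that] by (auto simp: U_def unit_vec_def inv)
    qed
  qed
qed

end

section \<open>Extension from a ball to the free group\<close>

lemma sum_words_Suc:
  fixes F :: "'a::finite list \<Rightarrow> 'b::comm_monoid_add"
  shows "sum F {w. length w \<le> Suc n} = F [] + (\<Sum>x\<in>UNIV. \<Sum>w | length w \<le> n. F (x # w))"
proof -
  let ?W = "\<lambda>n. {w :: 'a list. length w \<le> n}"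
  have W: "?W (Suc n) = insert [] ((\<lambda>(x, w). x # w) ` (UNIV \<times> ?W n))"
  proof (intro set_eqI iffI)
    fix w assume "w \<in> ?W (Suc n)"
    then show "w \<in> insert [] ((\<lambda>(x, w). x # w) ` (UNIV \<times> ?W n))" by (cases w) force+
  qed auto
  have "sum F ((\<lambda>(x, w). x # w) ` (UNIV \<times> ?W n)) = (\<Sum>(x, w)\<in>UNIV \<times> ?W n. F (x # w))"
    by (subst sum.reindex) (auto simp: inj_on_def case_prod_unfold)
  then show ?thesis
    unfolding W using finite_words_le[of n]
    by (subst sum.insert) (auto simp: sum.cartesian_product intro!: finite_imageI finite_cartesian_product)
qed

section \<open>Products of contractions along words and their positive definite kernel\<close>

locale letter_contractions = psd_kernel I G
  for I :: "'i set" and G :: "'i \<Rightarrow> 'i \<Rightarrow> complex" +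
  fixes T :: "'x::finite \<Rightarrow> ('i \<Rightarrow> complex) \<Rightarrow> 'i \<Rightarrow> complex"
  assumes T_add: "T x (u + v) = T x u + T x v"
    and T_scale: "T x (\<lambda>i. c * u i) = (\<lambda>i. c * T x u i)"
    and T_contraction: "Re (B (T x u) (T x u)) \<le> Re (B u u)"
begin

definition Tw :: "'x list \<Rightarrow> ('i \<Rightarrow> complex) \<Rightarrow> 'i \<Rightarrow> complex"
  where "Tw w u = foldr T w u"

lemma Tw_Nil [simp]: "Tw [] u = u"
  and Tw_Cons [simp]: "Tw (x # w) u = T x (Tw w u)"
  and Tw_append: "Tw (w @ w') u = Tw w (Tw w' u)"
  by (simp_all add: Tw_def)

lemma Tw_scale: "Tw w (\<lambda>i. c * u i) = (\<lambda>i. c * Tw w u i)"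
  by (induction w) (simp_all only: Tw_Nil Tw_Cons T_scale)

lemma T_zero: "T x 0 = 0"
  using T_scale[of x 0 0] by (simp add: zero_fun_def)

lemma T_sum: "T x (\<Sum>a\<in>A. f a) = (\<Sum>a\<in>A. T x (f a))"
  by (induction A rule: infinite_finite_induct)
     (simp_all only: sum.infinite sum.empty sum.insert T_zero T_add not_False_eq_True)

lemma Tw_sum: "Tw w (\<Sum>a\<in>A. f a) = (\<Sum>a\<in>A. Tw w (f a))"
  by (induction w) (simp_all only: Tw_Nil Tw_Cons T_sum)

text \<open>The common prefix is stripped before the contractions act. When inverse letters act by
  adjoints, this is the inner product of T_w u with v for w = h^{-1} g on reduced words; defining it
  on all words lets positivity be proved by induction on the length.\<close>

fun tree_kernel :: "'x list \<Rightarrow> 'x list \<Rightarrow> ('i \<Rightarrow> complex) \<Rightarrow> ('i \<Rightarrow> complex) \<Rightarrow> complex" where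
  "tree_kernel (x # g) (y # h) u v =
     (if x = y then tree_kernel g h u v else B (Tw (x # g) u) (Tw (y # h) v))"
| "tree_kernel g h u v = B (Tw g u) (Tw h v)"

lemma tree_kernel_Nil [simp]:
  "tree_kernel [] h u v = B u (Tw h v)" "tree_kernel g [] u v = B (Tw g u) v"
  by (cases h; simp) (cases g; simp)

lemma tree_kernel_hermitian: "tree_kernel h g v u = cnj (tree_kernel g h u v)"
  by (induction g h u v rule: tree_kernel.induct) (auto intro: B_hermitian)

text \<open>Pairs of words with different first letters contribute equally to both sides, so the
  difference of the two sides splits over the first letter.\<close>

lemma tree_kernel_dominates:
  fixes \<xi> :: "'x list \<Rightarrow> 'i \<Rightarrow> complex" and n :: nat
  defines "W \<equiv> {w :: 'x list. length w \<le> n}"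
  defines "y \<equiv> (\<Sum>g\<in>W. Tw g (\<xi> g))"
  shows "Re (B y y) \<le> Re (\<Sum>g\<in>W. \<Sum>h\<in>W. tree_kernel g h (\<xi> g) (\<xi> h))"
  unfolding y_def W_def
proof (induction n arbitrary: \<xi>)
  case 0
  then show ?case by simp
next
  case (Suc n)
  let ?W = "{w :: 'x list. length w \<le> n}" and ?W' = "{w :: 'x list. length w \<le> Suc n}"
  define D where "D g h = tree_kernel g h (\<xi> g) (\<xi> h) - B (Tw g (\<xi> g)) (Tw h (\<xi> h))" for g h
  let ?y = "\<lambda>x. \<Sum>g\<in>?W. Tw g (\<xi> (x # g))"
  have D_Cons: "D (x # g) (y # h) = (if x = y then
      tree_kernel g h (\<xi> (x # g)) (\<xi> (x # h))
        - B (T x (Tw g (\<xi> (x # g)))) (T x (Tw h (\<xi> (x # h)))) else 0)" for x y g h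
    by (simp add: D_def)
  have "(\<Sum>g\<in>?W'. \<Sum>h\<in>?W'. tree_kernel g h (\<xi> g) (\<xi> h))
      - B (\<Sum>g\<in>?W'. Tw g (\<xi> g)) (\<Sum>h\<in>?W'. Tw h (\<xi> h)) = (\<Sum>g\<in>?W'. \<Sum>h\<in>?W'. D g h)"
    unfolding D_def B_sum_sum by (simp add: sum_subtractf)
  also have "\<dots> = (\<Sum>x\<in>UNIV. \<Sum>g\<in>?W. \<Sum>y\<in>UNIV. \<Sum>h\<in>?W. D (x # g) (y # h))"
    by (simp add: sum_words_Suc D_def)
  also have "\<dots> = (\<Sum>x\<in>UNIV. \<Sum>g\<in>?W. \<Sum>h\<in>?W. D (x # g) (x # h))"
  proof (intro sum.cong refl)
    fix x g
    have "(\<Sum>y\<in>UNIV. \<Sum>h\<in>?W. D (x # g) (y # h)) =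
        (\<Sum>y\<in>UNIV. if x = y then \<Sum>h\<in>?W. D (x # g) (x # h) else 0)"
      by (intro sum.cong) (auto simp: D_Cons)
    then show "(\<Sum>y\<in>UNIV. \<Sum>h\<in>?W. D (x # g) (y # h)) = (\<Sum>h\<in>?W. D (x # g) (x # h))"
      by simp
  qed
  also have "\<dots> = (\<Sum>x\<in>UNIV. (\<Sum>g\<in>?W. \<Sum>h\<in>?W. tree_kernel g h (\<xi> (x # g)) (\<xi> (x # h)))
      - B (T x (?y x)) (T x (?y x)))"
    unfolding T_sum B_sum_sum by (simp add: D_Cons sum_subtractf)
  finally have eq: "(\<Sum>g\<in>?W'. \<Sum>h\<in>?W'. tree_kernel g h (\<xi> g) (\<xi> h))
      - B (\<Sum>g\<in>?W'. Tw g (\<xi> g)) (\<Sum>h\<in>?W'. Tw h (\<xi> h)) = \<dots>" .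
  \<comment> \<open>The induction hypothesis bounds the inner double sum below by the form at
    \<open>?y x\<close>, and the contraction property bounds that below by the form at
    \<open>T x (?y x)\<close>.\<close>
  have "0 \<le> Re ((\<Sum>g\<in>?W. \<Sum>h\<in>?W. tree_kernel g h (\<xi> (x # g)) (\<xi> (x # h)))
      - B (T x (?y x)) (T x (?y x)))" for x
    using Suc.IH[of "\<lambda>w. \<xi> (x # w)"] T_contraction[of x "?y x"] by simp
  then have "0 \<le> Re (\<Sum>x\<in>UNIV. (\<Sum>g\<in>?W. \<Sum>h\<in>?W. tree_kernel g h (\<xi> (x # g)) (\<xi> (x # h)))
      - B (T x (?y x)) (T x (?y x)))"
    unfolding Re_sum by (intro sum_nonneg)
  then show ?case unfolding eq[symmetric] by simp
qed

text \<open>By \<open>tree_kernel_dominates\<close> the sum is at least the form evaluated at a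
  single vector.\<close>

lemma tree_kernel_psd:
  fixes \<xi> :: "'x list \<Rightarrow> 'i \<Rightarrow> complex"
  assumes "finite S"
  defines "q \<equiv> (\<Sum>g\<in>S. \<Sum>h\<in>S. tree_kernel g h (\<xi> g) (\<xi> h))"
  shows "Im q = 0" and "0 \<le> Re q"
proof -
  have "cnj q = (\<Sum>g\<in>S. \<Sum>h\<in>S. tree_kernel h g (\<xi> h) (\<xi> g))"
    unfolding q_def by (simp add: tree_kernel_hermitian[symmetric])
  also have "\<dots> = q" unfolding q_def by (rule sum.swap)
  finally show "Im q = 0" by (simp add: complex_eq_iff)
  obtain n where n: "S \<subseteq> {w. length w \<le> n}"
    using finite_nat_set_iff_bounded_le[of "length ` S"] assms(1) by auto
  \<comment> \<open>Extending by zero turns the sum over \<open>S\<close> into one over all words of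
    bounded length, the shape required by the domination lemma.\<close>
  define \<eta> where "\<eta> w = (if w \<in> S then \<xi> w else 0)" for w
  have Tw_0: "Tw w 0 = 0" for w by (induction w) (simp_all only: Tw_Nil Tw_Cons T_zero)
  have B_0: "B v 0 = 0" for v by (simp add: gram_def)
  have ker_0: "tree_kernel g h 0 v = 0" "tree_kernel g h v 0 = 0" for g h v
    by (induction g h "0 :: 'i \<Rightarrow> complex" v rule: tree_kernel.induct)
       (simp_all only: tree_kernel.simps tree_kernel_Nil Tw_0 B_0 B_zero_left if_cancel
          cong: if_cong)
  have "q = (\<Sum>g | length g \<le> n. \<Sum>h | length h \<le> n. tree_kernel g h (\<eta> g) (\<eta> h))"
    unfolding q_def using n
    by (intro sum.mono_neutral_cong_left finite_words_le sum.neutral ballI)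
       (auto simp: \<eta>_def ker_0)
  then have "0 \<le> Re q - Re (B (\<Sum>g | length g \<le> n. Tw g (\<eta> g)) (\<Sum>g | length g \<le> n. Tw g (\<eta> g)))"
    using tree_kernel_dominates[where \<xi> = \<eta> and n = n] by simp
  then show "0 \<le> Re q"
    using Re_gram_self[of "\<Sum>g | length g \<le> n. Tw g (\<eta> g)"] by linarith
qed

end

section \<open>The matrix-valued quadratic form as a Gram form, and its extension\<close>

definition qf_psd :: "nat \<Rightarrow> (word \<Rightarrow> cmat) \<Rightarrow> word set \<Rightarrow> bool" where
  "qf_psd d C S \<longleftrightarrow> (\<forall>\<alpha>. Im (qf d C S \<alpha>) = 0 \<and> 0 \<le> Re (qf d C S \<alpha>))"

text \<open>The matrix indices are swapped because \<open>qf\<close> conjugates the coefficient at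
  h, which is the second argument of \<open>gram\<close>.\<close>

definition qf_kernel :: "(word \<Rightarrow> cmat) \<Rightarrow> word \<times> nat \<Rightarrow> word \<times> nat \<Rightarrow> complex" where
  "qf_kernel C p q = C (fg_mult (fg_inv (fst q)) (fst p)) (snd q) (snd p)"

lemma gram_qf_kernel: "gram (S \<times> {..<d}) (qf_kernel C) u u = qf d C S (\<lambda>g k. u (g, k))"
proof -
  have "gram (S \<times> {..<d}) (qf_kernel C) u u = (\<Sum>g\<in>S. \<Sum>k<d. \<Sum>h\<in>S. \<Sum>j<d.
      cnj (u (h, j)) * C (fg_mult (fg_inv h) g) j k * u (g, k))"
    by (simp add: gram_def sum.cartesian_product' qf_kernel_def mult_ac)
  also have "\<dots> = qf d C S (\<lambda>g k. u (g, k))"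
    unfolding qf_def
  proof (rule sum.cong[OF refl])
    fix g
    let ?F = "\<lambda>h j k. cnj (u (h, j)) * C (fg_mult (fg_inv h) g) j k * u (g, k)"
    have "(\<Sum>k<d. \<Sum>h\<in>S. \<Sum>j<d. ?F h j k) = (\<Sum>h\<in>S. \<Sum>k<d. \<Sum>j<d. ?F h j k)"
      by (rule sum.swap)
    also have "\<dots> = (\<Sum>h\<in>S. \<Sum>j<d. \<Sum>k<d. ?F h j k)"
      by (rule sum.cong[OF refl], rule sum.swap)
    finally show "(\<Sum>k<d. \<Sum>h\<in>S. \<Sum>j<d. ?F h j k) = (\<Sum>h\<in>S. \<Sum>j<d. \<Sum>k<d. ?F h j k)" .
  qed
  finally show ?thesis .
qed

lemma psd_kernel_qf_kernel:
  assumes "qf_psd d C S" "finite S"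
  shows "psd_kernel (S \<times> {..<d}) (qf_kernel C)"
  using assms by unfold_locales (simp_all add: gram_qf_kernel qf_psd_def)

lemma qf_cong:
  assumes "\<And>g h j k. g \<in> S \<Longrightarrow> h \<in> S \<Longrightarrow> j < d \<Longrightarrow> k < d \<Longrightarrow>
    C (fg_mult (fg_inv h) g) j k = D (fg_mult (fg_inv h) g) j k"
  shows "qf d C S \<alpha> = qf d D S \<alpha>"
  unfolding qf_def using assms by (intro sum.cong refl) simp

text \<open>Left translation by a letter is a partial symmetry of the kernel of \<open>C\<close> on the ball; the
  corresponding contractions \<open>T\<close> multiply along reduced words to a dilation of \<open>C\<close>.\<close>

lemma extension_from_ball:
  assumes "qf_psd d C (ball s)"
  obtains D where "\<And>S. finite S \<Longrightarrow> S \<subseteq> FG \<Longrightarrow> qf_psd d D S"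
    and "\<And>w j k. w \<in> ball (2 * s) \<Longrightarrow> j < d \<Longrightarrow> k < d \<Longrightarrow> D w j k = C w j k"
proof -
  define I where "I = ball s \<times> {..<d}"
  interpret K: psd_kernel I "qf_kernel C"
    unfolding I_def using assms by (intro psd_kernel_qf_kernel) auto
  \<comment> \<open>The domain of translation by \<open>x\<close>: the points of the ball that it
    keeps inside the ball.\<close>
  define L where "L x = {p \<in> I. cancel_cons x (fst p) \<in> ball s}" for x
  define \<sigma> where "\<sigma> x p = (cancel_cons x (fst p), snd p)" for x and p :: "word \<times> nat"
  have red: "reduced (fst p)" if "p \<in> L x" for p x
    using that by (auto simp: L_def I_def ball_iff)
  obtain T where T: "\<And>x u v. T x (u + v) = T x u + T x v"
      "\<And>x c u. T x (\<lambda>i. c * u i) = (\<lambda>i. c * T x u i)"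
      "\<And>x u v. K.B (T x u) v = K.B u (T (letter_inv x) v)"
      "\<And>x u. Re (K.B (T x u) (T x u)) \<le> Re (K.B u u)"
      "\<And>x i. i \<in> L x \<Longrightarrow> T x (unit_vec i) = unit_vec (\<sigma> x i)"
  proof (rule K.partial_symmetries_act[of L letter_inv \<sigma>])
    show "L x \<subseteq> I" for x by (auto simp: L_def)
    show "\<sigma> x i \<in> L (letter_inv x)" "\<sigma> (letter_inv x) (\<sigma> x i) = i" if "i \<in> L x" for x i
      using that red[OF that] by (auto simp: L_def \<sigma>_def I_def cancel_cons_inverse)
    show "qf_kernel C (\<sigma> x i) (\<sigma> x j) = qf_kernel C i j" if "i \<in> L x" "j \<in> L x" for x i j
      using red[OF that(1)] by (simp add: qf_kernel_def \<sigma>_def fg_mult_inv_cancel_cons)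
    show "letter_inv (letter_inv x) = x" for x by simp
  qed (use that in blast)
  interpret K: letter_contractions I "qf_kernel C" T
    by unfold_locales (rule T)+
  have adjoint: "K.B (K.Tw (fg_inv h) u) v = K.B u (K.Tw h v)" for h u v
    by (induction h arbitrary: u) (simp_all add: fg_inv_Cons K.Tw_append T(3))
  \<comment> \<open>Once the common prefix is gone, \<open>fg_inv h @ g\<close> is already reduced,
    so the operator product splits there and the factor of \<open>fg_inv h\<close> moves over as an
    adjoint.\<close>
  have kernel: "K.B (K.Tw (fg_mult (fg_inv h) g) u) v = K.tree_kernel g h u v"
    if "reduced g" "reduced h" for g h u v
    using that
  proof (induction g h u v rule: K.tree_kernel.induct)
    case (1 x g y h u v)
    show ?case
    proof (cases "x = y")
      case True
      then show ?thesis using 1 by (simp add: fg_mult_inv_Cons_Cons reduced_Cons)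
    next
      case False
      then show ?thesis using 1(2,3)
        by (simp add: fg_mult_inv_eq_append K.Tw_append adjoint del: K.Tw_Cons)
    qed
  qed (simp_all add: fg_mult_inv_eq_append K.Tw_append adjoint del: K.Tw_Cons)
  define e where "e k = unit_vec ([] :: word, k :: nat)" for k
  \<comment> \<open>The matrix of the operator product along \<open>w\<close>, compressed to the
    vectors at the identity.\<close>
  define D where "D w j k = K.B (K.Tw w (e k)) (e j)" for w j k
  \<comment> \<open>Every suffix of a word in the ball is in the ball, so each letter acts as a
    genuine translation.\<close>
  have Tw_e: "K.Tw g (e k) = unit_vec (g, k)" if "g \<in> ball s" "k < d" for g k
    using that(1)
  proof (induction g)
    case Nil
    then show ?case by (simp add: e_def)
  next
    case (Cons x g)
    then have "g \<in> ball s" "cancel_cons x g = x # g"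
      by (auto simp: ball_iff reduced_Cons cancel_cons_reduced)
    moreover from this have "(g, k) \<in> L x"
      using Cons.prems that(2) by (simp add: L_def I_def)
    ultimately show ?case using Cons.IH T(5) by (simp add: \<sigma>_def)
  qed
  show thesis
  proof (rule that[of D])
    fix S :: "word set"
    assume S: "finite S" "S \<subseteq> FG"
    have "qf d D S \<alpha> = (\<Sum>g\<in>S. \<Sum>h\<in>S. K.tree_kernel g h
        (\<Sum>k<d. (\<lambda>i. \<alpha> g k * e k i)) (\<Sum>j<d. (\<lambda>i. \<alpha> h j * e j i)))" for \<alpha>
      unfolding qf_def
    proof (intro sum.cong refl)
      fix g h assume "g \<in> S" "h \<in> S"
      then have "reduced g" "reduced h" using S by (auto simp: FG_def)
      then show "(\<Sum>j<d. \<Sum>k<d. cnj (\<alpha> h j) * D (fg_mult (fg_inv h) g) j k * \<alpha> g k) =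
        K.tree_kernel g h (\<Sum>k<d. (\<lambda>i. \<alpha> g k * e k i)) (\<Sum>j<d. (\<lambda>i. \<alpha> h j * e j i))"
        by (simp only: kernel[symmetric] K.Tw_sum K.Tw_scale K.B_sum_sum
              K.B_scale_left K.B_scale_right D_def)
           (subst sum.swap, simp add: sum_distrib_left mult_ac)
    qed
    then show "qf_psd d D S"
      using K.tree_kernel_psd[OF S(1)] by (simp only: qf_psd_def) blast
  next
    fix w j k assume w: "w \<in> ball (2 * s)" and jk: "j < d" "k < d"
    \<comment> \<open>Cutting \<open>w\<close> in the middle leaves two halves of length at most
      \<open>s\<close>, also for odd length; with h = u^{-1} and g = v both in the ball, h^{-1} g is
      \<open>w\<close>.\<close>
    define u where "u = take (length w div 2) w"
    define v where "v = drop (length w div 2) w"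
    have uv: "w = u @ v" by (simp add: u_def v_def)
    have red: "reduced (u @ v)" using w by (simp add: uv[symmetric] ball_iff)
    have "length u \<le> s" "length v \<le> s" using w by (auto simp: ball_iff u_def v_def)
    then have v: "v \<in> ball s" and u: "fg_inv u \<in> ball s"
      using red by (auto simp: ball_iff reduced_append reduced_fg_inv)
    have "D w j k = K.B (K.Tw (fg_inv (fg_inv u)) (K.Tw v (e k))) (e j)"
      by (simp add: D_def uv K.Tw_append)
    also have "\<dots> = K.B (unit_vec (v, k)) (unit_vec (fg_inv u, j))"
      by (simp only: adjoint Tw_e u v jk)
    also have "\<dots> = C (fg_mult u v) j k"
      using u v jk by (subst K.B_unit_vec) (auto simp: I_def qf_kernel_def)
    finally show "D w j k = C w j k"
      using fg_mult_eq_append[OF red] by (simp add: uv)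
  qed
qed

section \<open>Relative energies\<close>

lemma qf_zero:
  assumes "\<And>g j. g \<in> S \<Longrightarrow> j < d \<Longrightarrow> \<alpha> g j = 0"
  shows "qf d C S \<alpha> = 0"
  unfolding qf_def using assms by (intro sum.neutral ballI) simp

lemma qf_diff_scale:
  "qf d (\<lambda>g j k. C g j k - c * D g j k) S \<alpha> = qf d C S \<alpha> - c * qf d D S \<alpha>"
  by (simp add: qf_def algebra_simps sum_subtractf sum_distrib_left)

lemma qf_sum_scale:
  "qf d (\<lambda>g j k. \<Sum>m\<in>A. c m * C m g j k) S \<alpha> = (\<Sum>m\<in>A. c m * qf d (C m) S \<alpha>)"
proof -
  have "qf d (\<lambda>g j k. \<Sum>m\<in>A. c m * C m g j k) S \<alpha> = (\<Sum>g\<in>S. \<Sum>h\<in>S. \<Sum>j<d. \<Sum>k<d. \<Sum>m\<in>A.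
      c m * (cnj (\<alpha> h j) * C m (fg_mult (fg_inv h) g) j k * \<alpha> g k))"
    unfolding qf_def
    by (intro sum.cong refl) (simp add: sum_distrib_left sum_distrib_right mult_ac)
  also have "\<dots> = (\<Sum>m\<in>A. \<Sum>g\<in>S. \<Sum>h\<in>S. \<Sum>j<d. \<Sum>k<d.
      c m * (cnj (\<alpha> h j) * C m (fg_mult (fg_inv h) g) j k * \<alpha> g k))"
    by (simp only: sum.swap[of _ A])
  finally show ?thesis by (simp add: qf_def sum_distrib_left)
qed

lemma energy_ball_le:
  assumes "0 \<le> c"
    and "\<And>\<alpha>. 0 \<le> Re (qf d D (ball (r div 2)) \<alpha>)"
    and "\<And>\<alpha>. 0 \<le> Re (qf d C (ball (r div 2)) \<alpha>)"
    and "\<And>\<alpha>. Re (qf d D (ball (r div 2)) \<alpha>) \<le> c * Re (qf d C (ball (r div 2)) \<alpha>)"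
  shows "energy_ball d r C D \<le> ereal c"
  unfolding energy_ball_def
proof (rule Sup_least, clarify)
  fix \<alpha>
  let ?D = "Re (qf d D (ball (r div 2)) \<alpha>)" and ?C = "Re (qf d C (ball (r div 2)) \<alpha>)"
  show "en_ratio ?D ?C \<le> ereal c"
  proof (cases "?C = 0")
    \<comment> \<open>A zero denominator forces a zero numerator, so the ratio is 0 and not
      infinite.\<close>
    case True
    then show ?thesis using assms(1) assms(2)[of \<alpha>] assms(4)[of \<alpha>] by (simp add: en_ratio_def)
  next
    case False
    then have "0 < ?C" using assms(3)[of \<alpha>] by simp
    then show ?thesis using assms(4)[of \<alpha>] by (simp add: en_ratio_def pos_divide_le_eq)
  qed
qed

lemma energy_le:
  assumes C: "\<And>S. finite S \<Longrightarrow> S \<subseteq> FG \<Longrightarrow> qf_psd d C S"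
    and D: "\<And>S. finite S \<Longrightarrow> S \<subseteq> FG \<Longrightarrow> qf_psd d D S"
    and p: "0 < p"
    and le: "\<And>S \<alpha>. finite S \<Longrightarrow> S \<subseteq> FG \<Longrightarrow> p * Re (qf d D S \<alpha>) \<le> Re (qf d C S \<alpha>)"
  shows "energy d C D \<le> ereal (1 / p)"
  unfolding energy_def
proof (rule SUP_least, rule energy_ball_le)
  fix r \<alpha>
  show "0 \<le> Re (qf d D (ball (r div 2)) \<alpha>)" "0 \<le> Re (qf d C (ball (r div 2)) \<alpha>)"
    using C[OF finite_ball ball_subset_FG] D[OF finite_ball ball_subset_FG]
    by (auto simp: qf_psd_def)
  show "Re (qf d D (ball (r div 2)) \<alpha>) \<le> 1 / p * Re (qf d C (ball (r div 2)) \<alpha>)"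
    using p le[OF finite_ball ball_subset_FG, of "r div 2" \<alpha>]
    by (simp add: pos_le_divide_eq mult.commute)
qed (use p in simp)

section \<open>Energies between normalized strictly positive definite functions\<close>

lemma admissible_ball: "admissible (ball r) (ball (r div 2))"
proof -
  have "ball (2 * (r div 2)) \<subseteq> ball r" by (auto simp: ball_def)
  then show ?thesis
    using fg_mult_inv_in_ball ball_subset_FG by (auto simp: admissible_def)
qed

lemma NSPD_qf_psd: "C \<in> NSPD r d \<Longrightarrow> qf_psd d C (ball (r div 2))"
  using admissible_ball
  by (auto simp: NSPD_def strict_pos_def_on_def pos_def_on_def qf_psd_def)

lemma NSPD_qf_pos:
  assumes C: "C \<in> NSPD r d" and \<alpha>: "g \<in> ball (r div 2)" "j < d" "\<alpha> g j \<noteq> 0"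
  shows "0 < Re (qf d C (ball (r div 2)) \<alpha>)"
proof -
  have "qf d C (ball (r div 2)) \<alpha> \<noteq> 0"
    using C \<alpha> admissible_ball[of r] by (auto simp: NSPD_def strict_pos_def_on_def)
  with NSPD_qf_psd[OF C] show ?thesis
    by (metis complex_eq_iff order_le_less qf_psd_def zero_complex.sel)
qed

lemma NSPD_qf_unit_vec:
  assumes C: "C \<in> NSPD r d" and "1 \<le> d"
  shows "qf d C (ball (r div 2)) (\<lambda>g k. unit_vec ([], 0) (g, k)) = 1"
proof -
  interpret psd_kernel "ball (r div 2) \<times> {..<d}" "qf_kernel C"
    using NSPD_qf_psd[OF C] by (rule psd_kernel_qf_kernel) simp
  have "B (unit_vec ([], 0)) (unit_vec ([], 0)) = 1"
    using assms by (subst B_unit_vec) (auto simp: qf_kernel_def NSPD_def normalized_def)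
  then show ?thesis by (simp add: gram_qf_kernel)
qed

text \<open>By normalization both forms equal 1 at the unit vector of the identity, so 1 is among
  the ratios.\<close>

lemma one_le_energy_ball:
  assumes "C \<in> NSPD r d" "D \<in> NSPD r d" "1 \<le> d"
  shows "1 \<le> energy_ball d r C D"
proof -
  let ?\<alpha> = "\<lambda>g k. unit_vec ([] :: word, 0 :: nat) (g, k)"
  have "en_ratio (Re (qf d D (ball (r div 2)) ?\<alpha>)) (Re (qf d C (ball (r div 2)) ?\<alpha>)) = 1"
    using assms by (simp add: NSPD_qf_unit_vec en_ratio_def one_ereal_def)
  moreover have "\<exists>g\<in>ball (r div 2). \<exists>j<d. ?\<alpha> g j \<noteq> 0"
    using assms(3) by (auto simp: unit_vec_def intro!: bexI[of _ "[]"])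
  ultimately show ?thesis
    unfolding energy_ball_def by (intro Sup_upper2[where u = 1]) (auto intro!: exI[of _ ?\<alpha>])
qed

text \<open>The reciprocal energy. An infinite energy gets weight 0, since
  \<open>real_of_ereal\<close> sends it to 0 and \<open>inverse 0 = 0\<close>.\<close>

definition energy_weight :: "nat \<Rightarrow> nat \<Rightarrow> (word \<Rightarrow> cmat) \<Rightarrow> (word \<Rightarrow> cmat) \<Rightarrow> real" where
  "energy_weight d r C D = inverse (real_of_ereal (energy_ball d r C D))"

text \<open>The last claim is the positivity of the residual. Strict positivity makes the
  denominators positive when \<alpha> is nonzero on the ball; otherwise both forms vanish.\<close>

lemma energy_weight:
  assumes C: "C \<in> NSPD r d" and D: "D \<in> NSPD r d" and d: "1 \<le> d"
  defines "p \<equiv> energy_weight d r C D"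
  shows "0 \<le> p" and "p \<le> 1"
    and "energy_ball d r C D = (if p = 0 then \<infinity> else ereal (1 / p))"
    and "p * Re (qf d D (ball (r div 2)) \<alpha>) \<le> Re (qf d C (ball (r div 2)) \<alpha>)"
proof -
  consider "energy_ball d r C D = \<infinity>" "p = 0"
    | x where "energy_ball d r C D = ereal x" "1 \<le> x" "p = 1 / x"
    using one_le_energy_ball[OF C D d]
    by (cases "energy_ball d r C D")
       (auto simp: p_def energy_weight_def one_ereal_def inverse_eq_divide)
  note cases = this
  show "0 \<le> p" "p \<le> 1" "energy_ball d r C D = (if p = 0 then \<infinity> else ereal (1 / p))"
    by (rule cases; simp)+
  show "p * Re (qf d D (ball (r div 2)) \<alpha>) \<le> Re (qf d C (ball (r div 2)) \<alpha>)"
  proof (cases rule: cases)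
    case 1
    then show ?thesis using NSPD_qf_psd[OF C] by (simp add: qf_psd_def)
  next
    case (2 x)
    show ?thesis
    proof (cases "\<exists>g\<in>ball (r div 2). \<exists>j<d. \<alpha> g j \<noteq> 0")
      case True
      then have pos: "0 < Re (qf d C (ball (r div 2)) \<alpha>)"
        using NSPD_qf_pos[OF C] by blast
      have "en_ratio (Re (qf d D (ball (r div 2)) \<alpha>)) (Re (qf d C (ball (r div 2)) \<alpha>)) \<le> ereal x"
        unfolding 2(1)[symmetric] energy_ball_def using True by (intro Sup_upper) blast
      then have "Re (qf d D (ball (r div 2)) \<alpha>) \<le> x * Re (qf d C (ball (r div 2)) \<alpha>)"
        using pos by (simp add: en_ratio_def pos_divide_le_eq)
      then show ?thesis using 2 by (simp add: pos_divide_le_eq mult.commute)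
    next
      case False
      then show ?thesis by (simp add: qf_zero)
    qed
  qed
qed

section \<open>Functional graphs\<close>

text \<open>Exact extensions satisfy the closeness condition for every tolerance, and energies that
  do not grow along edges make \<open>M = 1\<close> admissible.\<close>

lemma encost_cfg_le_one:
  assumes "0 < \<epsilon>"
    and psd: "\<And>v S. v \<in> V \<Longrightarrow> finite S \<Longrightarrow> S \<subseteq> FG \<Longrightarrow> qf_psd d (Ch v) S"
    and C: "\<And>v. v \<in> V \<Longrightarrow> C v \<in> NSPD r d"
    and agree: "\<And>v \<alpha>. v \<in> V \<Longrightarrow>
      Re (qf d (Ch v) (ball (r div 2)) \<alpha>) = Re (qf d (C v) (ball (r div 2)) \<alpha>)"
    and edges: "\<And>v w. (v, w) \<in> E \<Longrightarrow> energy d (Ch v) (Ch w) \<le> energy_ball d r (C v) (C w)"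
  shows "encost_cfg d r \<epsilon> V E C \<le> 1"
proof -
  have "pos_def d (Ch v)" if "v \<in> V" for v
    using psd[OF that] by (auto simp: pos_def_def pos_def_on_def admissible_def qf_psd_def)
  moreover have "max (energy_ball d r (C v) (Ch v)) (energy_ball d r (Ch v) (C v)) \<le> ereal (1 + \<epsilon>)"
    if "v \<in> V" for v
    using NSPD_qf_psd[OF C[OF that]] \<open>0 < \<epsilon>\<close>
    by (intro max.boundedI energy_ball_le)
       (auto simp: agree[OF that] qf_psd_def distrib_right)
  moreover have "energy d (Ch v) (Ch w) - 1 \<le> ereal 1 * (energy_ball d r (C v) (C w) - 1)"
    if "(v, w) \<in> E" for v w
    using edges[OF that] by (simp add: one_ereal_def[symmetric] ereal_minus_mono)
  ultimately have "1 \<in> {M. 1 \<le> M \<and> (\<exists>Ch :: 'a \<Rightarrow> word \<Rightarrow> cmat.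
      (\<forall>v\<in>V. pos_def d (Ch v) \<and>
          max (energy_ball d r (C v) (Ch v)) (energy_ball d r (Ch v) (C v)) \<le> ereal (1 + \<epsilon>)) \<and>
      (\<forall>(v, w)\<in>E. energy d (Ch v) (Ch w) - 1 \<le> ereal M * (energy_ball d r (C v) (C w) - 1)))}"
    by (intro CollectI conjI exI[of _ Ch]) auto
  then show ?thesis
    unfolding encost_cfg_def one_ereal_def by (intro Inf_lower imageI)
qed

text \<open>With \<open>p v = 1 / e(C v, C (f v))\<close> the residual \<open>R v = C v - p v C (f v)\<close> is positive definite on
  the ball. Iterating \<open>C v = R v + p v C (f v)\<close> writes \<open>C v\<close> as a nonnegative combination of the residuals
  along the forward orbit of \<open>v\<close>; the same combination of extensions of the residuals extends \<open>C v\<close>.\<close>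

lemma encost_cfg_functional_graph:
  fixes f :: "'v \<Rightarrow> 'v" and p :: "'v \<Rightarrow> real" and C :: "'v \<Rightarrow> word \<Rightarrow> cmat"
  assumes \<epsilon>: "0 < \<epsilon>"
    and C: "\<And>v. v \<in> V \<Longrightarrow> C v \<in> NSPD r d"
    and f: "\<And>v. v \<in> V \<Longrightarrow> f v \<in> V"
    and p: "\<And>v. v \<in> V \<Longrightarrow> 0 \<le> p v"
    and residual: "\<And>v \<alpha>. v \<in> V \<Longrightarrow>
      p v * Re (qf d (C (f v)) (ball (r div 2)) \<alpha>) \<le> Re (qf d (C v) (ball (r div 2)) \<alpha>)"
    and edges: "\<And>v w. (v, w) \<in> E \<Longrightarrow> v \<in> V \<and> w = f v \<and>
      energy_ball d r (C v) (C w) = (if p v = 0 then \<infinity> else ereal (1 / p v))"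
    and orbit_prod: "\<And>v. v \<in> V \<Longrightarrow> (\<Prod>j<N. p ((f ^^ j) v)) = q"
    and q: "q < 1"
    and periodic: "\<And>v. v \<in> V \<Longrightarrow> q = 0 \<or> (f ^^ N) v = v"
  shows "encost_cfg d r \<epsilon> V E C \<le> 1"
proof -
  define s where "s = r div 2"
  define R where "R v = (\<lambda>g j k. C v g j k - of_real (p v) * C (f v) g j k)" for v
  have qf_R: "qf d (R v) S \<alpha> = qf d (C v) S \<alpha> - of_real (p v) * qf d (C (f v)) S \<alpha>" for v S \<alpha>
    unfolding R_def by (rule qf_diff_scale)
  have "qf_psd d (R v) (ball s)" if "v \<in> V" for v
    using NSPD_qf_psd[OF C[OF that]] NSPD_qf_psd[OF C[OF f[OF that]]] residual[OF that]
    by (simp add: qf_psd_def qf_R s_def)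
  then have "\<exists>D. (\<forall>S. finite S \<longrightarrow> S \<subseteq> FG \<longrightarrow> qf_psd d D S) \<and>
      (\<forall>w\<in>ball (2 * s). \<forall>j<d. \<forall>k<d. D w j k = R v w j k)" if "v \<in> V" for v
    by (rule extension_from_ball[of d "R v" s]) (use that in blast)+
  then have "\<forall>v. \<exists>D. v \<in> V \<longrightarrow> (\<forall>S. finite S \<longrightarrow> S \<subseteq> FG \<longrightarrow> qf_psd d D S) \<and>
      (\<forall>w\<in>ball (2 * s). \<forall>j<d. \<forall>k<d. D w j k = R v w j k)"
    by blast
  from choice[OF this] obtain Rh where Rh: "\<forall>v. v \<in> V \<longrightarrow>
      (\<forall>S. finite S \<longrightarrow> S \<subseteq> FG \<longrightarrow> qf_psd d (Rh v) S) \<and>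
      (\<forall>w\<in>ball (2 * s). \<forall>j<d. \<forall>k<d. Rh v w j k = R v w j k)" ..
  then have Rh_psd: "qf_psd d (Rh v) S" if "v \<in> V" "finite S" "S \<subseteq> FG" for v S
    using that by blast
  have Rh_ball: "qf d (Rh v) (ball s) \<alpha> = qf d (R v) (ball s) \<alpha>" if "v \<in> V" for v \<alpha>
    using Rh that fg_mult_inv_in_ball by (intro qf_cong) blast
  have orbit: "(f ^^ m) v \<in> V" if "v \<in> V" for m v
    using that by (induction m) (auto intro: f)
  \<comment> \<open>The coefficient of the residual at the m-th orbit point when the recursion for
    \<open>C v\<close> is unrolled.\<close>
  define \<pi> where "\<pi> m v = (\<Prod>j<m. p ((f ^^ j) v))" for m v
  have \<pi>_nonneg: "0 \<le> \<pi> m v" if "v \<in> V" for m v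
    unfolding \<pi>_def using that by (intro prod_nonneg ballI p orbit)
  have \<pi>_0: "\<pi> 0 v = 1" and \<pi>_Suc: "\<pi> (Suc m) v = \<pi> m v * p ((f ^^ m) v)"
    and \<pi>_shift: "\<pi> (Suc m) v = p v * \<pi> m (f v)" for m v
    by (simp add: \<pi>_def, simp add: \<pi>_def,
        simp add: \<pi>_def prod.lessThan_Suc_shift funpow_swap1 del: prod.lessThan_Suc)
  \<comment> \<open>After \<open>N\<close> steps the remainder is either zero or \<open>q\<close>
    times the starting term, because the orbit has returned.\<close>
  have \<pi>_N: "of_real (\<pi> N v) * X ((f ^^ N) v) = of_real q * X v"
    if "v \<in> V" for v and X :: "'v \<Rightarrow> complex"
    using orbit_prod[OF that] periodic[OF that] by (auto simp: \<pi>_def)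
  \<comment> \<open>The unrolled series over the infinite orbit: each further block of
    \<open>N\<close> steps repeats the first with an extra factor \<open>q\<close>, and the
    geometric series gives 1 / (1 - q).\<close>
  define Ch where "Ch v = (\<lambda>g j k. \<Sum>m<N. of_real (\<pi> m v / (1 - q)) * Rh ((f ^^ m) v) g j k)" for v
  have qf_Ch: "qf d (Ch v) S \<alpha> = (\<Sum>m<N. of_real (\<pi> m v / (1 - q)) * qf d (Rh ((f ^^ m) v)) S \<alpha>)"
    for v S \<alpha>
    unfolding Ch_def by (rule qf_sum_scale)
  have Ch_psd: "qf_psd d (Ch v) S" if v: "v \<in> V" and S: "finite S" "S \<subseteq> FG" for v S
    unfolding qf_psd_def
  proof
    fix \<alpha>
    have "Im (qf d (Rh ((f ^^ m) v)) S \<alpha>) = 0" "0 \<le> Re (qf d (Rh ((f ^^ m) v)) S \<alpha>)" for m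
      using Rh_psd[OF orbit[OF v] S] by (auto simp: qf_psd_def)
    then show "Im (qf d (Ch v) S \<alpha>) = 0 \<and> 0 \<le> Re (qf d (Ch v) S \<alpha>)"
      unfolding qf_Ch using \<pi>_nonneg[OF v] q
      by (auto simp: Re_divide_of_real simp del: of_real_divide intro!: sum_nonneg)
  qed
  have Ch_ball: "qf d (Ch v) (ball s) \<alpha> = qf d (C v) (ball s) \<alpha>" if v: "v \<in> V" for v \<alpha>
  proof -
    define X where "X w = qf d (C w) (ball s) \<alpha>" for w
    have "of_real (1 - q) * qf d (Ch v) (ball s) \<alpha> =
        (\<Sum>m<N. of_real (\<pi> m v) * qf d (Rh ((f ^^ m) v)) (ball s) \<alpha>)"
      unfolding qf_Ch sum_distrib_left using q by (intro sum.cong) (auto simp flip: of_real_diff)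
    \<comment> \<open>Substituting the definition of the residual makes the sum telescope.\<close>
    also have "\<dots> = (\<Sum>m<N. of_real (\<pi> m v) * X ((f ^^ m) v)
        - of_real (\<pi> (Suc m) v) * X ((f ^^ Suc m) v))"
      by (intro sum.cong)
         (simp_all add: Rh_ball[OF orbit[OF v]] qf_R \<pi>_Suc X_def algebra_simps)
    also have "\<dots> = X v - of_real (\<pi> N v) * X ((f ^^ N) v)"
      by (subst sum_lessThan_telescope') (simp add: \<pi>_0)
    also have "\<dots> = of_real (1 - q) * X v"
      by (simp add: \<pi>_N[OF v] algebra_simps)
    finally show ?thesis using q by (simp add: X_def flip: of_real_diff)
  qed
  \<comment> \<open>The extensions satisfy the recursion of the \<open>C v\<close> on all of the
    free group, so positivity of \<open>Rh v\<close> bounds the energy along the edge by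
    \<open>1 / p v\<close>.\<close>
  have Ch_step: "qf d (Ch v) S \<alpha> - of_real (p v) * qf d (Ch (f v)) S \<alpha> = qf d (Rh v) S \<alpha>"
    if v: "v \<in> V" for v S \<alpha>
  proof -
    define Y where "Y w = qf d (Rh w) S \<alpha>" for w
    have "of_real (1 - q) * (qf d (Ch v) S \<alpha> - of_real (p v) * qf d (Ch (f v)) S \<alpha>) =
        (\<Sum>m<N. of_real (1 - q) * (of_real (\<pi> m v / (1 - q)) * Y ((f ^^ m) v)
          - of_real (p v) * (of_real (\<pi> m (f v) / (1 - q)) * Y ((f ^^ m) (f v)))))"
      by (simp only: qf_Ch Y_def sum_distrib_left sum_subtractf right_diff_distrib)
    also have "\<dots> = (\<Sum>m<N. of_real (\<pi> m v) * Y ((f ^^ m) v)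
        - of_real (\<pi> (Suc m) v) * Y ((f ^^ Suc m) v))"
    proof (intro sum.cong refl)
      fix m
      have cancel: "a * (x / a * y - b * (z / a * w)) = x * y - b * z * w" if "a \<noteq> 0"
        for a b x y z w :: complex
        using that by (simp add: right_diff_distrib)
      have "complex_of_real (1 - q) \<noteq> 0" using q by (simp flip: of_real_diff)
      then show "of_real (1 - q) * (of_real (\<pi> m v / (1 - q)) * Y ((f ^^ m) v)
          - of_real (p v) * (of_real (\<pi> m (f v) / (1 - q)) * Y ((f ^^ m) (f v)))) =
        of_real (\<pi> m v) * Y ((f ^^ m) v) - of_real (\<pi> (Suc m) v) * Y ((f ^^ Suc m) v)"
        by (simp only: \<pi>_shift of_real_divide of_real_mult funpow_Suc_right comp_apply
              cancel not_False_eq_True)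
    qed
    also have "\<dots> = Y v - of_real (\<pi> N v) * Y ((f ^^ N) v)"
      by (subst sum_lessThan_telescope') (simp add: \<pi>_0)
    also have "\<dots> = of_real (1 - q) * Y v"
      by (simp add: \<pi>_N[OF v] algebra_simps)
    finally show ?thesis using q by (simp add: Y_def flip: of_real_diff)
  qed
  show ?thesis
  proof (rule encost_cfg_le_one[OF \<epsilon> Ch_psd C])
    show "Re (qf d (Ch v) (ball (r div 2)) \<alpha>) = Re (qf d (C v) (ball (r div 2)) \<alpha>)" if "v \<in> V" for v \<alpha>
      using Ch_ball[OF that] by (simp add: s_def)
    fix v w assume "(v, w) \<in> E"
    from edges[OF this] have v: "v \<in> V" and w: "w = f v"
      and e: "energy_ball d r (C v) (C w) = (if p v = 0 then \<infinity> else ereal (1 / p v))" by auto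
    show "energy d (Ch v) (Ch w) \<le> energy_ball d r (C v) (C w)"
    proof (cases "p v = 0")
      case True
      then show ?thesis by (simp add: e)
    next
      case False
      then have "0 < p v" using p[OF v] by simp
      have "energy d (Ch v) (Ch w) \<le> ereal (1 / p v)"
      proof (rule energy_le[OF Ch_psd[OF v] _ \<open>0 < p v\<close>])
        show "qf_psd d (Ch w) S" if "finite S" "S \<subseteq> FG" for S
          using Ch_psd[OF f[OF v] that] by (simp add: w)
        show "p v * Re (qf d (Ch w) S \<alpha>) \<le> Re (qf d (Ch v) S \<alpha>)" if "finite S" "S \<subseteq> FG" for S \<alpha>
          using arg_cong[OF Ch_step[OF v], of Re S \<alpha>] Rh_psd[OF v that]
          by (simp add: w qf_psd_def) (metis diff_ge_0_iff_ge)
      qed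
      then show ?thesis by (simp add: e False)
    qed
  qed
qed

section \<open>Trees directed toward a root\<close>

lemma encost_cfg_tree:
  fixes V :: "'v set"
  assumes \<epsilon>: "0 < \<epsilon>" and "finite V" and E: "E \<subseteq> V \<times> V" and tree: "tree_toward_root V E"
    and C: "\<And>v. v \<in> V \<Longrightarrow> C v \<in> NSPD r d" and d: "1 \<le> d"
  shows "encost_cfg d r \<epsilon> V E C \<le> 1"
proof -
  obtain \<rho> where root: "\<rho> \<in> V" "\<forall>(v, w)\<in>E. v \<noteq> \<rho>" "\<forall>v\<in>V - {\<rho>}. \<exists>!w. (v, w) \<in> E"
      "\<forall>v\<in>V. (v, \<rho>) \<in> E\<^sup>*"
    using tree unfolding tree_toward_root_def by (elim bexE conjE)
  have no_exit: "v \<noteq> \<rho>" if "(v, w) \<in> E" for v w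
    using root(2) that by auto
  note \<rho> = root(1) no_exit root(3,4)[rule_format]
  \<comment> \<open>The root is turned into a fixed point, and the next line gives it weight 0; its
    residual is then \<open>C \<rho>\<close> itself.\<close>
  define f where "f v = (if v = \<rho> then \<rho> else THE w. (v, w) \<in> E)" for v
  define p where "p v = (if v = \<rho> then 0 else energy_weight d r (C v) (C (f v)))" for v
  have fE: "(v, f v) \<in> E" if "v \<in> V" "v \<noteq> \<rho>" for v
    using theI'[OF \<rho>(3)[of v]] that by (simp add: f_def)
  have f: "f v \<in> V" if "v \<in> V" for v
    using fE[OF that] E \<rho>(1) that by (cases "v = \<rho>") (auto simp: f_def)
  have f_edge: "w = f v" if "(v, w) \<in> E" for v w
    using \<rho>(2)[OF that] \<rho>(3)[of v] fE[of v] E that by blast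
  note weight = energy_weight[OF C C[OF f] d]
  have "\<exists>k. (f ^^ k) v = \<rho>" if "v \<in> V" for v
    using \<rho>(4)[OF that]
  proof (induction rule: converse_rtrancl_induct)
    case base
    show ?case by (rule exI[of _ 0]) simp
  next
    case (step v w)
    then obtain k where "(f ^^ k) w = \<rho>" by blast
    then have "(f ^^ Suc k) v = \<rho>" using f_edge[OF step(1)] by (simp add: funpow_swap1)
    then show ?case by blast
  qed
  then obtain k where k: "\<And>v. v \<in> V \<Longrightarrow> (f ^^ k v) v = \<rho>" by metis
  \<comment> \<open>The successor makes \<open>k v < N\<close>, so every product over
    \<open>N\<close> steps contains the zero weight of the root.\<close>
  define N where "N = Suc (Max (k ` V))"
  show ?thesis
  proof (rule encost_cfg_functional_graph[where f = f and p = p and N = N and q = 0, OF \<epsilon> C f])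
    show "0 \<le> p v" if "v \<in> V" for v
      using weight(1)[OF that that] by (simp add: p_def)
    show "p v * Re (qf d (C (f v)) (ball (r div 2)) \<alpha>) \<le> Re (qf d (C v) (ball (r div 2)) \<alpha>)"
      if "v \<in> V" for v \<alpha>
      using weight(4)[OF that that] NSPD_qf_psd[OF C[OF that]] by (auto simp: p_def qf_psd_def)
    show "v \<in> V \<and> w = f v \<and>
        energy_ball d r (C v) (C w) = (if p v = 0 then \<infinity> else ereal (1 / p v))"
      if "(v, w) \<in> E" for v w
      using that E \<rho>(2)[OF that] f_edge[OF that] weight(3)[of v v] by (auto simp: p_def)
    show "(\<Prod>j<N. p ((f ^^ j) v)) = 0" if "v \<in> V" for v
    proof (rule prod_zero)
      have "k v \<le> Max (k ` V)" using \<open>finite V\<close> that by simp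
      then show "\<exists>j\<in>{..<N}. p ((f ^^ j) v) = 0"
        by (intro bexI[of _ "k v"]) (simp_all add: k[OF that] p_def N_def)
    qed simp
  qed simp_all
qed

section \<open>Directed cycles\<close>

lemma prod_periodic_shift:
  fixes a :: "nat \<Rightarrow> 'a::comm_monoid_mult"
  assumes "\<And>j. a (j + n) = a j"
  shows "(\<Prod>j<n. a (i + j)) = (\<Prod>j<n. a j)"
proof (induction i)
  case (Suc i)
  show ?case
  proof (cases n)
    case (Suc m)
    have "(\<Prod>j<n. a (Suc i + j)) = (\<Prod>j<m. a (i + Suc j)) * a (i + n)"
      by (simp add: Suc)
    also have "\<dots> = a (i + 0) * (\<Prod>j<m. a (i + Suc j))"
      by (simp add: assms mult.commute)
    also have "\<dots> = (\<Prod>j<n. a (i + j))"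
      unfolding Suc by (rule prod.lessThan_Suc_shift[symmetric])
    finally show ?thesis using \<open>(\<Prod>j<n. a (i + j)) = (\<Prod>j<n. a j)\<close> by simp
  qed simp
qed simp

text \<open>All weights lie in [0, 1]. If their product round the cycle is below 1, the orbit series
  converges; if it is 1, one common extension serves all vertices.\<close>

lemma encost_cfg_cycle:
  fixes V :: "'v set"
  assumes \<epsilon>: "0 < \<epsilon>" and cycle: "directed_cycle V E"
    and C: "\<And>v. v \<in> V \<Longrightarrow> C v \<in> NSPD r d" and d: "1 \<le> d"
  shows "encost_cfg d r \<epsilon> V E C \<le> 1"
proof -
  obtain n :: nat and \<phi> :: "nat \<Rightarrow> 'v" where n: "1 \<le> n" and \<phi>: "bij_betw \<phi> {..<n} V"
    and E: "E = {(\<phi> i, \<phi> ((i + 1) mod n)) | i. i < n}"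
    using cycle unfolding directed_cycle_def by blast
  define f where "f v = \<phi> ((inv_into {..<n} \<phi> v + 1) mod n)" for v
  define p where "p v = energy_weight d r (C v) (C (f v))" for v
  have V: "\<exists>i<n. v = \<phi> i" if "v \<in> V" for v
    using \<phi> that by (auto simp: bij_betw_def)
  have \<phi>_V: "\<phi> (i mod n) \<in> V" for i
    using \<phi> n by (auto simp: bij_betw_def)
  have f_\<phi>: "f (\<phi> i) = \<phi> ((i + 1) mod n)" if "i < n" for i
    using \<phi> that by (simp add: f_def bij_betw_inv_into_left)
  have f: "f v \<in> V" for v unfolding f_def by (rule \<phi>_V)
  have pow: "(f ^^ m) (\<phi> i) = \<phi> ((i + m) mod n)" if "i < n" for m i
  proof (induction m)
    case (Suc m)
    have "(f ^^ Suc m) (\<phi> i) = \<phi> (((i + m) mod n + 1) mod n)"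
      using Suc n by (simp add: f_\<phi>)
    then show ?case by (simp add: mod_Suc_eq)
  qed (use that in simp)
  have period: "(f ^^ n) v = v" if "v \<in> V" for v
    using V[OF that] pow by auto
  have weight: "0 \<le> p v" "p v \<le> 1"
    "energy_ball d r (C v) (C (f v)) = (if p v = 0 then \<infinity> else ereal (1 / p v))"
    "p v * Re (qf d (C (f v)) (ball (r div 2)) \<alpha>) \<le> Re (qf d (C v) (ball (r div 2)) \<alpha>)"
    if "v \<in> V" for v \<alpha>
    unfolding p_def by (rule energy_weight[OF C[OF that] C[OF f] d])+
  define q where "q = (\<Prod>j<n. p (\<phi> (j mod n)))"
  \<comment> \<open>The remaining weights have product at most 1. Hence \<open>q = 1\<close> forces
    every weight to be 1.\<close>
  have q_le: "q \<le> p v" if "v \<in> V" for v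
  proof -
    obtain i where i: "i < n" "v = \<phi> i" using V[OF \<open>v \<in> V\<close>] by blast
    have "q = p (\<phi> (i mod n)) * (\<Prod>j\<in>{..<n} - {i}. p (\<phi> (j mod n)))"
      unfolding q_def using i by (intro prod.remove) auto
    also have "\<dots> \<le> p (\<phi> (i mod n)) * 1"
      by (intro mult_left_mono prod_le_1 conjI weight \<phi>_V)
    finally show ?thesis using i by simp
  qed
  have edges: "v \<in> V \<and> w = f v \<and>
      energy_ball d r (C v) (C w) = (if p v = 0 then \<infinity> else ereal (1 / p v))"
    if "(v, w) \<in> E" for v w
  proof -
    obtain i where i: "i < n" "v = \<phi> i" "w = \<phi> ((i + 1) mod n)"
      using \<open>(v, w) \<in> E\<close> E by blast
    then have "v \<in> V" "w = f v" using \<phi>_V[of i] by (simp_all add: f_\<phi>)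
    then show ?thesis using weight(3) by simp
  qed
  show ?thesis
  proof (cases "q < 1")
    case True
    show ?thesis
    proof (rule encost_cfg_functional_graph[where f = f and p = p and N = n and q = q, OF \<epsilon> C f])
      show "(\<Prod>j<n. p ((f ^^ j) v)) = q" if "v \<in> V" for v
      proof -
        obtain i where i: "i < n" "v = \<phi> i" using V[OF \<open>v \<in> V\<close>] by blast
        then show ?thesis
          \<comment> \<open>The product of the weights round the cycle does not depend on the
            starting vertex.\<close>
          unfolding q_def using prod_periodic_shift[of "\<lambda>j. p (\<phi> (j mod n))" n i]
          by (simp add: pow)
      qed
      show "q = 0 \<or> (f ^^ n) v = v" if "v \<in> V" for v
        using period[OF that] by blast
    qed (use weight edges True in auto)
  next
    case False
    txt \<open>All relative energies are 1, so the forms decrease along the cycle and hence all agree.\<close>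
    then have p1: "p v = 1" if "v \<in> V" for v
      using q_le[OF that] weight(2)[OF that] by simp
    define v0 where "v0 = \<phi> 0"
    have v0: "v0 \<in> V" using \<phi>_V[of 0] by (simp add: v0_def)
    define X where "X \<alpha> v = Re (qf d (C v) (ball (r div 2)) \<alpha>)" for \<alpha> v
    have orbit: "(f ^^ m) v \<in> V" if "v \<in> V" for m v
      using that f by (cases m) auto
    have decreasing: "X \<alpha> ((f ^^ m) v) \<le> X \<alpha> v" if "v \<in> V" for \<alpha> m v
    proof (induction m)
      case (Suc m)
      have "X \<alpha> (f ((f ^^ m) v)) \<le> X \<alpha> ((f ^^ m) v)"
        using weight(4)[OF orbit[OF that], of m \<alpha>] p1[OF orbit[OF that]] by (simp add: X_def)
      with Suc show ?case by simp
    qed simp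
    have X_eq: "X \<alpha> v = X \<alpha> v0" if v: "v \<in> V" for v \<alpha>
    proof -
      obtain i where i: "i < n" "v = \<phi> i" using V[OF v] by blast
      \<comment> \<open>Walking from \<open>v0\<close> to \<open>v\<close> and then on to
        \<open>v0\<close> gives the two opposite inequalities.\<close>
      have "(f ^^ i) v0 = v" using i n pow[of 0 i] by (simp add: v0_def)
      moreover have "(f ^^ (n - i)) v = v0" using i pow[of i "n - i"] by (simp add: v0_def)
      ultimately show ?thesis
        using decreasing[OF v0, of \<alpha> i] decreasing[OF v, of \<alpha> "n - i"] by simp
    qed
    obtain D where D: "\<And>S. finite S \<Longrightarrow> S \<subseteq> FG \<Longrightarrow> qf_psd d D S"
      "\<And>w j k. w \<in> ball (2 * (r div 2)) \<Longrightarrow> j < d \<Longrightarrow> k < d \<Longrightarrow> D w j k = C v0 w j k"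
      using extension_from_ball[OF NSPD_qf_psd[OF C[OF v0]]] by blast
    show ?thesis
    proof (rule encost_cfg_le_one[where Ch = "\<lambda>_. D", OF \<epsilon> D(1) C])
      show "Re (qf d D (ball (r div 2)) \<alpha>) = Re (qf d (C v) (ball (r div 2)) \<alpha>)"
        if "v \<in> V" for v \<alpha>
      proof -
        have "qf d D (ball (r div 2)) \<alpha> = qf d (C v0) (ball (r div 2)) \<alpha>"
          by (intro qf_cong D(2) fg_mult_inv_in_ball)
        then show ?thesis using X_eq[OF that] by (simp add: X_def)
      qed
      show "energy d D D \<le> energy_ball d r (C v) (C w)" if "(v, w) \<in> E" for v w
      proof -
        have "energy_ball d r (C v) (C w) = ereal 1" using edges[OF that] p1[of v] by auto
        then show ?thesis using energy_le[OF D(1) D(1), of 1] by simp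
      qed
    qed
  qed
qed

section \<open>Existence of a configuration and the final equality\<close>

lemma NSPD_nonempty: "NSPD r d \<noteq> {}"
proof -
  \<comment> \<open>The delta function at the identity is the simplest witness: its form is the sum
    of the squared moduli of the coefficients.\<close>
  define \<delta> :: "word \<Rightarrow> cmat" where "\<delta> g j k = (if g = [] \<and> j = k then 1 else 0)" for g j k
  have qf: "qf d \<delta> S \<alpha> = of_real (\<Sum>g\<in>S. \<Sum>j<d. (cmod (\<alpha> g j))\<^sup>2)"
    if S: "S \<subseteq> FG" "finite S" for S \<alpha>
  proof -
    have "qf d \<delta> S \<alpha> = (\<Sum>g\<in>S. \<Sum>h\<in>S. if h = g then
        \<Sum>j<d. \<Sum>k<d. if k = j then of_real ((cmod (\<alpha> g j))\<^sup>2) else 0 else 0)"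
      unfolding qf_def
    proof (intro sum.cong refl)
      fix g h assume "g \<in> S" "h \<in> S"
      then have "fg_mult (fg_inv h) g = [] \<longleftrightarrow> g = h"
        using S by (intro fg_mult_inv_eq_Nil_iff) (auto simp: FG_def)
      then show "(\<Sum>j<d. \<Sum>k<d. cnj (\<alpha> h j) * \<delta> (fg_mult (fg_inv h) g) j k * \<alpha> g k) =
        (if h = g then \<Sum>j<d. \<Sum>k<d. if k = j then of_real ((cmod (\<alpha> g j))\<^sup>2) else 0 else 0)"
      proof (cases "h = g")
        case True
        then have "cnj (\<alpha> h j) * \<delta> (fg_mult (fg_inv h) g) j k * \<alpha> g k =
            (if k = j then of_real ((cmod (\<alpha> g j))\<^sup>2) else 0)" for j k
          using \<open>fg_mult (fg_inv h) g = [] \<longleftrightarrow> g = h\<close>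
          by (simp add: \<delta>_def complex_norm_square mult.commute del: of_real_power)
        then show ?thesis by (simp only: True if_True refl)
      next
        case False
        then show ?thesis
          using \<open>fg_mult (fg_inv h) g = [] \<longleftrightarrow> g = h\<close> by (auto simp: \<delta>_def)
      qed
    qed
    then show ?thesis using S by simp
  qed
  have "\<delta> \<in> NSPD r d"
    unfolding NSPD_def strict_pos_def_on_def pos_def_on_def admissible_def normalized_def
  proof (intro CollectI conjI allI impI ballI; (elim conjE)?)
    fix S \<alpha> g j
    assume S: "S \<subseteq> FG" "finite S" and 0: "qf d \<delta> S \<alpha> = 0" and gj: "g \<in> S" "j < d"
    have "(\<Sum>g\<in>S. \<Sum>j<d. (cmod (\<alpha> g j))\<^sup>2) = 0"
      using 0 unfolding qf[OF S] by (simp only: of_real_eq_0_iff)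
    then have "(\<Sum>j<d. (cmod (\<alpha> g j))\<^sup>2) = 0"
      using S(2) gj by (subst (asm) sum_nonneg_eq_0_iff) (auto intro: sum_nonneg)
    then show "\<alpha> g j = 0"
      using gj by (subst (asm) sum_nonneg_eq_0_iff) auto
  qed (auto simp: qf \<delta>_def intro!: sum_nonneg simp del: of_real_sum)
  then show ?thesis by blast
qed

theorem theorem1:
  fixes V :: "'v set" and E :: "('v \<times> 'v) set" and r :: nat and \<epsilon> :: real
  assumes "finite V" and "E \<subseteq> V \<times> V"
    and "tree_toward_root V E \<or> directed_cycle V E"
    and "\<epsilon> > 0"
  shows "encost r \<epsilon> V E = 1"
proof (rule antisym)
  show "encost r \<epsilon> V E \<le> 1"
    unfolding encost_def
  proof (intro SUP_least)
    fix d C assume "d \<in> {1 :: nat..}" "C \<in> {C. \<forall>v\<in>V. C v \<in> NSPD r d}"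
    then show "encost_cfg d r \<epsilon> V E C \<le> 1"
      using assms encost_cfg_tree[of \<epsilon> V E C r d] encost_cfg_cycle[of \<epsilon> V E C r d] by auto
  qed
  \<comment> \<open>For the lower bound one constant configuration in dimension 1 suffices, since
    the infimum ranges over \<open>M \<ge> 1\<close>.\<close>
  obtain D where "D \<in> NSPD r 1" using NSPD_nonempty by blast
  moreover have "1 \<le> encost_cfg 1 r \<epsilon> V E (\<lambda>_. D)"
    unfolding encost_cfg_def by (intro Inf_greatest) (auto simp: one_ereal_def)
  ultimately show "1 \<le> encost r \<epsilon> V E"
    unfolding encost_def
    by (intro SUP_upper2[of 1] SUP_upper2[of "\<lambda>_. D"]) auto
qed

end
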